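(* Let $\mathcal{I},\mathcal{J}$ be $\sigma$-ideals on an uncountable Polish space $\mathcal{X}$, each containing all countable subsets of $\mathcal{X}$ and having a Borel base. Let $(\mathbb{P},\le)$ be a forcing notion such that, for $G$ $\mathbb{P}$-generic over $V$, the family $$\{B: B\in\mathcal{I}\cap\mathrm{Borel}(\mathcal{X}),\ B\text{ is coded in }V\}$$ is a base for $\mathcal{I}$ in $V[G]$. Assume that Borel codes for sets from the ideals $\mathcal{I}$ and $\mathcal{J}$ are absolute. Then $(\mathbb{P},\le)$ preserves being an $(\mathcal{I},\mathcal{J})$-Luzin set.
   Context: A $\sigma$-ideal on $\mathcal{X}$ is a family of subsets of $\mathcal{X}$ closed under countable unions and subsets; it has a Borel base if each of its members is contained in a Borel set belonging to the ideal. A subfamily $\mathcal{A}\subseteq\mathcal{I}$ is a base of $\mathcal{I}$ if every $I\in\mathcal{I}$ is contained in some $A\in\mathcal{A}$. Every Borel set is coded by some $x\in\omega^\omega$; $\#x$ denotes the Borel set coded by $x$ (interpreted in the model under consideration). A Borel set of $V[G]$ is coded in $V$ if it equals $\#x$ for some code $x\in\omega^\omega\cap V$. The ideals are given by definitions which are interpreted in each model. Borel codes for sets from $\mathcal{I}$ are absolute if, for the models $V\subseteq V[G]$ and every Borel code $x\in V\cap\omega^\omega$: $V\models\#x\in\mathcal{I}$ iff $V[G]\models\#x\in\mathcal{I}$; similarly for $\mathcal{J}$. $L\subseteq\mathcal{X}$ is an $(\mathcal{I},\mathcal{J})$-Luzin set if $L\notin\mathcal{I}$ and $B\cap L\in\mathcal{J}$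 for every $B\in\mathcal{I}$. A forcing $\mathbb{P}$ preserves being an $(\mathcal{I},\mathcal{J})$-Luzin set if every $L\in V$ that is an $(\mathcal{I},\mathcal{J})$-Luzin set in $V$ is an $(\mathcal{I},\mathcal{J})$-Luzin set in $V[G]$ for every $\mathbb{P}$-generic $G$ over $V$. *)

theory Defs
  imports "HOL-Analysis.Analysis" "HOL-Library.Countable_Set_Type"
begin

section \<open>Hereditarily countable sets\<close>

text \<open>
  HOL has no type of all sets, so forcing is rendered in the usual way over transitive set models.
  By Mostowski collapse every countable well-founded extensional structure is isomorphic to
  a transitive subset of the type below, so this type contains all countable transitive models.
\<close>

datatype hc = HC "hc cset"

primrec elts :: "hc \<Rightarrow> hc set" where
  "elts (HC A) = rcset A"

text \<open>Meaningful for countable \<open>A\<close> only.\<close>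

definition hset :: "hc set \<Rightarrow> hc" where
  "hset A = HC (acset A)"

lemma elts_hset [simp]: "countable A \<Longrightarrow> elts (hset A) = A"
  by (simp add: hset_def)

lemma countable_elts [simp]: "countable (elts x)"
  by (cases x) simp

lemma hc_ext: "elts x = elts y \<Longrightarrow> x = y"
  by (cases x; cases y) (simp add: rcset_inject)

definition mem_rel :: "(hc \<times> hc) set" where
  "mem_rel = {(x, y). x \<in> elts y}"

lemma wf_mem_rel: "wf mem_rel"
proof (rule wfUNIVI)
  fix P :: "hc \<Rightarrow> bool" and x
  assume *: "\<forall>x. (\<forall>y. (y, x) \<in> mem_rel \<longrightarrow> P y) \<longrightarrow> P x"
  show "P x"
  proof (induction x)
    case (HC A)
    then show ?case
      using * by (auto simp: mem_rel_def cin_def)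
  qed
qed

definition hpair :: "hc \<Rightarrow> hc \<Rightarrow> hc" where
  "hpair x y = hset {hset {x}, hset {x, y}}"

lemma elts_hpair: "elts (hpair x y) = {hset {x}, hset {x, y}}"
  by (simp add: hpair_def)

lemma hpair_inject [simp]: "hpair x y = hpair x' y' \<longleftrightarrow> x = x' \<and> y = y'"
proof
  assume "hpair x y = hpair x' y'"
  then have "elts ` elts (hpair x y) = elts ` elts (hpair x' y')"
    by simp
  then have "{{x}, {x, y}} = {{x'}, {x', y'}}"
    by (simp add: elts_hpair)
  then show "x = x' \<and> y = y'"
    by (auto simp: doubleton_eq_iff)
qed simp

primrec vn :: "nat \<Rightarrow> hc" where
  "vn 0 = hset {}"
| "vn (Suc n) = hset (insert (vn n) (elts (vn n)))"

definition set_code :: "nat set \<Rightarrow> hc" where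
  "set_code A = hset (vn ` A)"

definition fun_code :: "(nat \<Rightarrow> nat) \<Rightarrow> hc" where
  "fun_code x = hset (range (\<lambda>n. hpair (vn n) (vn (x n))))"


section \<open>Transitive models of ZFC\<close>

text \<open>First-order formulas of the language of set theory, with de Bruijn indices.\<close>

datatype fm = FMem nat nat | FEq nat nat | FNeg fm | FConj fm fm | FAll fm

primrec sat :: "hc set \<Rightarrow> fm \<Rightarrow> (nat \<Rightarrow> hc) \<Rightarrow> bool" where
  "sat M (FMem i j) e \<longleftrightarrow> e i \<in> elts (e j)"
| "sat M (FEq i j) e \<longleftrightarrow> e i = e j"
| "sat M (FNeg \<phi>) e \<longleftrightarrow> \<not> sat M \<phi> e"
| "sat M (FConj \<phi> \<psi>) e \<longleftrightarrow> sat M \<phi> e \<and> sat M \<psi> e"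
| "sat M (FAll \<phi>) e \<longleftrightarrow> (\<forall>x\<in>M. sat M \<phi> (case_nat x e))"

definition transitive_model :: "hc set \<Rightarrow> bool" where
  "transitive_model M \<longleftrightarrow> (\<forall>x\<in>M. elts x \<subseteq> M)"

definition sat_extensionality :: "hc set \<Rightarrow> bool" where
  "sat_extensionality M \<longleftrightarrow>
    (\<forall>x\<in>M. \<forall>y\<in>M. (\<forall>z\<in>M. z \<in> elts x \<longleftrightarrow> z \<in> elts y) \<longrightarrow> x = y)"

definition sat_foundation :: "hc set \<Rightarrow> bool" where
  "sat_foundation M \<longleftrightarrow>
    (\<forall>x\<in>M. (\<exists>y\<in>M. y \<in> elts x) \<longrightarrow>
      (\<exists>y\<in>M. y \<in> elts x \<and> \<not> (\<exists>z\<in>M. z \<in> elts x \<and> z \<in> elts y)))"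

definition sat_pairing :: "hc set \<Rightarrow> bool" where
  "sat_pairing M \<longleftrightarrow>
    (\<forall>x\<in>M. \<forall>y\<in>M. \<exists>z\<in>M. \<forall>w\<in>M. w \<in> elts z \<longleftrightarrow> w = x \<or> w = y)"

definition sat_union :: "hc set \<Rightarrow> bool" where
  "sat_union M \<longleftrightarrow>
    (\<forall>x\<in>M. \<exists>u\<in>M. \<forall>w\<in>M. w \<in> elts u \<longleftrightarrow> (\<exists>y\<in>M. y \<in> elts x \<and> w \<in> elts y))"

definition sat_power :: "hc set \<Rightarrow> bool" where
  "sat_power M \<longleftrightarrow>
    (\<forall>x\<in>M. \<exists>p\<in>M. \<forall>w\<in>M. w \<in> elts p \<longleftrightarrow> (\<forall>z\<in>M. z \<in> elts w \<longrightarrow> z \<in> elts x))"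

definition sat_infinity :: "hc set \<Rightarrow> bool" where
  "sat_infinity M \<longleftrightarrow>
    (\<exists>x\<in>M. (\<exists>z\<in>M. z \<in> elts x \<and> (\<forall>w\<in>M. w \<notin> elts z)) \<and>
      (\<forall>y\<in>M. y \<in> elts x \<longrightarrow>
        (\<exists>s\<in>M. s \<in> elts x \<and> (\<forall>w\<in>M. w \<in> elts s \<longleftrightarrow> w \<in> elts y \<or> w = y))))"

definition sat_separation :: "hc set \<Rightarrow> bool" where
  "sat_separation M \<longleftrightarrow>
    (\<forall>\<phi> e. range e \<subseteq> M \<longrightarrow>
      (\<forall>a\<in>M. \<exists>b\<in>M. \<forall>x\<in>M. x \<in> elts b \<longleftrightarrow> x \<in> elts a \<and> sat M \<phi> (case_nat x e)))"

definition sat_replacement :: "hc set \<Rightarrow> bool" where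
  "sat_replacement M \<longleftrightarrow>
    (\<forall>\<phi> e. range e \<subseteq> M \<longrightarrow>
      (\<forall>a\<in>M.
        (\<forall>x\<in>M. x \<in> elts a \<longrightarrow> (\<exists>!y. y \<in> M \<and> sat M \<phi> (case_nat x (case_nat y e)))) \<longrightarrow>
        (\<exists>b\<in>M. \<forall>y\<in>M. y \<in> elts b \<longleftrightarrow>
          (\<exists>x\<in>M. x \<in> elts a \<and> sat M \<phi> (case_nat x (case_nat y e))))))"

definition sat_choice :: "hc set \<Rightarrow> bool" where
  "sat_choice M \<longleftrightarrow>
    (\<forall>f\<in>M.
      (\<forall>x\<in>M. x \<in> elts f \<longrightarrow> (\<exists>y\<in>M. y \<in> elts x)) \<and>
      (\<forall>x\<in>M. \<forall>y\<in>M. x \<in> elts f \<and> y \<in> elts f \<and> x \<noteq> y \<longrightarrow>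
        \<not> (\<exists>z\<in>M. z \<in> elts x \<and> z \<in> elts y)) \<longrightarrow>
      (\<exists>c\<in>M. \<forall>x\<in>M. x \<in> elts f \<longrightarrow> (\<exists>!y. y \<in> M \<and> y \<in> elts x \<and> y \<in> elts c)))"

definition transitive_model_ZFC :: "hc set \<Rightarrow> bool" where
  "transitive_model_ZFC M \<longleftrightarrow>
    transitive_model M \<and> sat_extensionality M \<and> sat_foundation M \<and> sat_pairing M \<and>
    sat_union M \<and> sat_power M \<and> sat_infinity M \<and> sat_separation M \<and> sat_replacement M \<and>
    sat_choice M"


section \<open>Forcing\<close>

definition hrel :: "hc \<Rightarrow> hc rel" where
  "hrel r = {(x, y). hpair x y \<in> elts r}"

definition forcing_notion :: "hc set \<Rightarrow> hc \<Rightarrow> hc \<Rightarrow> bool" where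
  "forcing_notion M P le \<longleftrightarrow>
    P \<in> M \<and> le \<in> M \<and> elts P \<noteq> {} \<and> preorder_on (elts P) (hrel le)"

definition dense_in :: "hc \<Rightarrow> hc \<Rightarrow> hc set \<Rightarrow> bool" where
  "dense_in P le D \<longleftrightarrow> D \<subseteq> elts P \<and> (\<forall>p\<in>elts P. \<exists>q\<in>D. (q, p) \<in> hrel le)"

definition generic :: "hc set \<Rightarrow> hc \<Rightarrow> hc \<Rightarrow> hc set \<Rightarrow> bool" where
  "generic M P le G \<longleftrightarrow>
    G \<subseteq> elts P \<and> G \<noteq> {} \<and>
    (\<forall>p\<in>G. \<forall>q\<in>elts P. (p, q) \<in> hrel le \<longrightarrow> q \<in> G) \<and>
    (\<forall>p\<in>G. \<forall>q\<in>G. \<exists>r\<in>G. (r, p) \<in> hrel le \<and> (r, q) \<in> hrel le) \<and>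
    (\<forall>D\<in>M. dense_in P le (elts D) \<longrightarrow> G \<inter> elts D \<noteq> {})"

inductive is_name :: "hc \<Rightarrow> hc \<Rightarrow> bool" for P where
  "(\<And>z. z \<in> elts \<tau> \<Longrightarrow> \<exists>\<sigma> p. z = hpair \<sigma> p \<and> is_name P \<sigma> \<and> p \<in> elts P) \<Longrightarrow> is_name P \<tau>"

lemma mem_rel_trancl_hpair: "hpair \<sigma> p \<in> elts \<tau> \<Longrightarrow> (\<sigma>, \<tau>) \<in> mem_rel\<^sup>+"
proof -
  assume "hpair \<sigma> p \<in> elts \<tau>"
  then have "(\<sigma>, hset {\<sigma>}) \<in> mem_rel" "(hset {\<sigma>}, hpair \<sigma> p) \<in> mem_rel" "(hpair \<sigma> p, \<tau>) \<in> mem_rel"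
    by (simp_all add: mem_rel_def elts_hpair)
  then show ?thesis
    by (meson trancl.simps)
qed

function val :: "hc set \<Rightarrow> hc \<Rightarrow> hc" where
  "val G \<tau> = hset (val G ` {\<sigma>. \<exists>p\<in>G. hpair \<sigma> p \<in> elts \<tau>})"
  by auto
termination
proof (relation "inv_image (mem_rel\<^sup>+) snd")
  show "wf (inv_image (mem_rel\<^sup>+) snd)"
    by (intro wf_inv_image wf_trancl wf_mem_rel)
qed (auto intro: mem_rel_trancl_hpair)

declare val.simps [simp del]

lemma elts_val: "elts (val G \<tau>) = {val G \<sigma> | \<sigma> p. p \<in> G \<and> hpair \<sigma> p \<in> elts \<tau>}"
proof -
  have "{\<sigma>. \<exists>p\<in>G. hpair \<sigma> p \<in> elts \<tau>} \<subseteq> (\<lambda>z. SOME \<sigma>. \<exists>p. z = hpair \<sigma> p) ` elts \<tau>"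
    by (force simp: image_iff)
  then have "countable {\<sigma>. \<exists>p\<in>G. hpair \<sigma> p \<in> elts \<tau>}"
    by (rule countable_subset) simp
  then show ?thesis
    by (subst val.simps) auto
qed

definition gen_ext :: "hc set \<Rightarrow> hc \<Rightarrow> hc set \<Rightarrow> hc set" where
  "gen_ext M P G = val G ` {\<tau> \<in> M. is_name P \<tau>}"


section \<open>Polish spaces and Borel codes, interpreted in a model\<close>

definition sets_in :: "hc set \<Rightarrow> hc set set" where
  "sets_in N = elts ` N"

text \<open>The graph of an injection of \<open>A\<close> into \<open>\<omega>\<close> belongs to \<open>N\<close>.\<close>

definition countable_in :: "hc set \<Rightarrow> hc set \<Rightarrow> bool" where
  "countable_in N A \<longleftrightarrow>
    (\<exists>f\<in>N. \<exists>g :: hc \<Rightarrow> nat. inj_on g A \<and> elts f = (\<lambda>x. hpair x (vn (g x))) ` A)"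

text \<open>
  A nonnegative function \<open>f : \<omega> \<rightarrow> \<real>\<close> is coded by its rational cuts
  \<open>{(i, m, k). f i < m / (k + 1)}\<close>, regarded as a subset of \<open>\<omega>\<close>.
\<close>

definition rat_of_code :: "nat \<Rightarrow> real" where
  "rat_of_code n = (case prod_decode n of (m, k) \<Rightarrow> real m / real (Suc k))"

definition cut_code :: "(nat \<Rightarrow> real) \<Rightarrow> hc" where
  "cut_code f = set_code {prod_encode (i, r) | i r. f i < rat_of_code r}"

definition metric_code :: "(nat \<Rightarrow> nat \<Rightarrow> real) \<Rightarrow> hc" where
  "metric_code d = cut_code (\<lambda>n. case prod_decode n of (i, j) \<Rightarrow> d i j)"

text \<open>
  A Polish space is presented by a metric \<open>d\<close> on a countable dense set, enumerated by \<open>\<omega>\<close>, and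
  interpreted in each model as the completion computed there. The completion is realised by the
  Kuratowski embedding: a point \<open>x\<close> is the function \<open>i \<mapsto> dist(i, x)\<close>, so that the points of a model
  are literally points of every larger model.
\<close>

definition completion :: "(nat \<Rightarrow> nat \<Rightarrow> real) \<Rightarrow> (nat \<Rightarrow> real) set" where
  "completion d = {f. \<forall>\<epsilon>>0. \<exists>n. \<forall>i. \<bar>f i - d n i\<bar> \<le> \<epsilon>}"

definition points :: "(nat \<Rightarrow> nat \<Rightarrow> real) \<Rightarrow> hc set \<Rightarrow> hc set" where
  "points d N = cut_code ` completion d \<inter> N"

text \<open>The \<open>n\<close>-th open ball with centre in the dense set and rational radius.\<close>

definition basic_open :: "(nat \<Rightarrow> nat \<Rightarrow> real) \<Rightarrow> hc set \<Rightarrow> nat \<Rightarrow> hc set" where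
  "basic_open d N n =
    (case prod_decode n of (i, r) \<Rightarrow> cut_code ` {f \<in> completion d. f i < rat_of_code r} \<inter> N)"

text \<open>\<open>codes d N c B\<close>: \<open>c\<close> is a Borel code and \<open>B\<close> is the set \<open>#c\<close> as interpreted in \<open>N\<close>.\<close>

inductive codes :: "(nat \<Rightarrow> nat \<Rightarrow> real) \<Rightarrow> hc set \<Rightarrow> (nat \<Rightarrow> nat) \<Rightarrow> hc set \<Rightarrow> bool"
  for d N where
  compl: "c 0 = 0 \<Longrightarrow> codes d N (\<lambda>n. c (Suc n)) B \<Longrightarrow> codes d N c (points d N - B)"
| union: "c 0 = 1 \<Longrightarrow> (\<And>i. codes d N (\<lambda>n. c (Suc (prod_encode (i, n)))) (B i)) \<Longrightarrow>
    codes d N c (\<Union>i. B i)"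
| opens: "c 0 > 1 \<Longrightarrow> codes d N c (\<Union>n\<in>{n. c (Suc n) = 1}. basic_open d N n)"

lemma codes_unique: "codes d N c B \<Longrightarrow> codes d N c B' \<Longrightarrow> B = B'"
proof (induction arbitrary: B' rule: codes.induct)
  case (compl c B)
  note IH1 = compl.IH
  from compl.prems show ?case
  proof cases
    case (compl B2)
    then show ?thesis using IH1 by simp
  qed (use compl.hyps in simp_all)
next
  case (union c B)
  note IH2 = union.IH
  from union.prems show ?case
  proof cases
    case (union B2)
    then have "B = B2" using IH2 by blast
    with union show ?thesis by simp
  qed (use union.hyps in simp_all)
next
  case (opens c)
  from opens.prems show ?case
    by cases (use opens.hyps in simp_all)
qed

definition borel_coded :: "(nat \<Rightarrow> nat \<Rightarrow> real) \<Rightarrow> hc set \<Rightarrow> hc set \<Rightarrow> hc set set" where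
  "borel_coded d N M = {B. \<exists>c. fun_code c \<in> M \<and> codes d N c B}"

text \<open>The Borel sets of \<open>N\<close>; \<open>borel_coded d N M\<close> consists of those coded in \<open>M \<subseteq> N\<close>.\<close>

abbreviation borel_in :: "(nat \<Rightarrow> nat \<Rightarrow> real) \<Rightarrow> hc set \<Rightarrow> hc set set" where
  "borel_in d N \<equiv> borel_coded d N N"


section \<open>Ideals and Luzin sets, interpreted in a model\<close>

text \<open>
  An ideal is given by a formula \<open>\<phi>\<close> with parameters \<open>e\<close>; variable 0 stands for the set, variable
  \<open>i + 1\<close> for the parameter \<open>e i\<close>.
\<close>

definition interp :: "fm \<Rightarrow> (nat \<Rightarrow> hc) \<Rightarrow> hc set \<Rightarrow> hc set set" where
  "interp \<phi> e N = elts ` {A \<in> N. sat N \<phi> (case_nat A e)}"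

definition sigma_ideal_in :: "hc set \<Rightarrow> hc set \<Rightarrow> hc set set \<Rightarrow> bool" where
  "sigma_ideal_in N X I \<longleftrightarrow>
    I \<subseteq> sets_in N \<and> (\<forall>A\<in>I. A \<subseteq> X) \<and>
    (\<forall>A\<in>I. \<forall>B\<in>sets_in N. B \<subseteq> A \<longrightarrow> B \<in> I) \<and>
    (\<forall>F\<in>N. countable_in N (elts F) \<and> elts ` elts F \<subseteq> I \<longrightarrow> \<Union>(elts ` elts F) \<in> I)"

definition is_base :: "hc set set \<Rightarrow> hc set set \<Rightarrow> bool" where
  "is_base \<A> I \<longleftrightarrow> \<A> \<subseteq> I \<and> (\<forall>A\<in>I. \<exists>B\<in>\<A>. A \<subseteq> B)"

definition borel_sigma_ideal_in ::
    "(nat \<Rightarrow> nat \<Rightarrow> real) \<Rightarrow> hc set \<Rightarrow> hc set set \<Rightarrow> bool" where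
  "borel_sigma_ideal_in d N I \<longleftrightarrow>
    sigma_ideal_in N (points d N) I \<and>
    (\<forall>A\<in>sets_in N. A \<subseteq> points d N \<and> countable_in N A \<longrightarrow> A \<in> I) \<and>
    is_base (I \<inter> borel_in d N) I"

text \<open>Here \<open>I\<close> assigns to each model the interpretation of the ideal in it.\<close>

definition codes_absolute ::
    "(nat \<Rightarrow> nat \<Rightarrow> real) \<Rightarrow> (hc set \<Rightarrow> hc set set) \<Rightarrow> hc set \<Rightarrow> hc set \<Rightarrow> bool" where
  "codes_absolute d I M N \<longleftrightarrow>
    (\<forall>c B B'. fun_code c \<in> M \<and> codes d M c B \<and> codes d N c B' \<longrightarrow> (B \<in> I M \<longleftrightarrow> B' \<in> I N))"

definition luzin_in :: "hc set \<Rightarrow> hc set \<Rightarrow> hc set set \<Rightarrow> hc set set \<Rightarrow> hc set \<Rightarrow> bool" where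
  "luzin_in N X I J L \<longleftrightarrow>
    L \<in> sets_in N \<and> L \<subseteq> X \<and> L \<notin> I \<and> (\<forall>B\<in>I. B \<inter> L \<in> J)"

definition preserves_luzin ::
    "hc set \<Rightarrow> hc \<Rightarrow> hc \<Rightarrow> (nat \<Rightarrow> nat \<Rightarrow> real) \<Rightarrow>
     (hc set \<Rightarrow> hc set set) \<Rightarrow> (hc set \<Rightarrow> hc set set) \<Rightarrow> bool" where
  "preserves_luzin M P le d I J \<longleftrightarrow>
    (\<forall>L. luzin_in M (points d M) (I M) (J M) L \<longrightarrow>
      (\<forall>G. generic M P le G \<longrightarrow>
        luzin_in (gen_ext M P G) (points d (gen_ext M P G))
          (I (gen_ext M P G)) (J (gen_ext M P G)) L))"

end

theory Submission
  imports Defs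
begin

text \<open>
  Let \<open>N = V[G]\<close>. Both parts of the Luzin property are transported between \<open>V\<close> and \<open>N\<close> by Borel
  codes. If \<open>c \<in> V\<close> codes \<open>B\<close> in \<open>N\<close>, then it codes \<open>B \<inter> V\<close> in \<open>V\<close> (\<open>codes_Int\<close>), because the
  points of \<open>V\<close> are points of \<open>N\<close> and the Boolean operations commute with intersecting by \<open>V\<close>.
  Hence every \<open>A \<in> I(N)\<close> has, by the assumption on the base, a superset \<open>B\<close> with \<open>B \<inter> V \<in> I(V)\<close>.

  Let \<open>L\<close> be a Luzin set of \<open>V\<close>. If \<open>L\<close> were in \<open>I(N)\<close>, then \<open>L \<subseteq> B \<inter> V \<in> I(V)\<close> for some
  such \<open>B\<close>, which is impossible. If \<open>A \<in> I(N)\<close> and \<open>B\<close> is as above, then \<open>B \<inter> L \<in> J(V)\<close>, so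
  \<open>B \<inter> L\<close> lies in a Borel set of \<open>J(V)\<close>, whose code defines in \<open>N\<close> a larger set of \<open>J(N)\<close>. Thus
  \<open>A \<inter> L\<close> is contained in a member of \<open>J(N)\<close>. This is \<open>luzin_in_extend\<close>.

  The argument uses two facts about \<open>N\<close>: it contains \<open>V\<close> (\<open>ground_model_subset\<close>), and it contains
  \<open>A \<inter> L\<close> whenever it contains \<open>A\<close> and \<open>L\<close> (\<open>sets_in_gen_ext_Int\<close>). The first needs the canonical
  names, that is, a recursion carried out inside \<open>V\<close> by replacement. For the second, full
  separation in \<open>N\<close>, and with it forcing for all formulas, can be avoided: a name for the
  intersection of the values of \<open>\<sigma>\<close> and \<open>\<tau>\<close> only has to refer to the conditions that force an
  equality between an element of \<open>\<sigma>\<close> and an element of \<open>\<tau>\<close>. On a transitive set of names, the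
  forcing relation for equality is obtained without recursion, as the largest bisimulation in \<open>V\<close>
  (\<open>ex_forces_eq_on\<close>); that it decides equality in \<open>N\<close> is \<open>forces_eq_on_val\<close>.
\<close>

section \<open>Definability over a transitive model\<close>

text \<open>
  Formulas with de Bruijn indices are unreadable, so definability is a property of predicates on
  environments. The closure rules below have the shape of the logical connectives; resolving with
  them produces the formula from the intended predicate. A quantifier shifts the environment.
\<close>

definition definable :: "hc set \<Rightarrow> ((nat \<Rightarrow> hc) \<Rightarrow> bool) \<Rightarrow> bool" where
  "definable V R \<longleftrightarrow> (\<exists>\<phi>. \<forall>e. range e \<subseteq> V \<longrightarrow> (sat V \<phi> e \<longleftrightarrow> R e))"

lemma range_case_nat: "x \<in> V \<Longrightarrow> range e \<subseteq> V \<Longrightarrow> range (case_nat x e) \<subseteq> V"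
  by (auto split: nat.splits simp: image_subset_iff)

lemma range_const: "x \<in> V \<Longrightarrow> range (\<lambda>_. x) \<subseteq> V"
  by auto

lemma definable_cong:
  assumes "definable V R" and "\<And>e. range e \<subseteq> V \<Longrightarrow> R e \<longleftrightarrow> S e"
  shows "definable V S"
  using assms unfolding definable_def by metis

lemma definable_mem: "definable V (\<lambda>e. e i \<in> elts (e j))"
  unfolding definable_def by (rule exI[of _ "FMem i j"]) simp

lemma definable_eq: "definable V (\<lambda>e. e i = e j)"
  unfolding definable_def by (rule exI[of _ "FEq i j"]) simp

lemma definable_not:
  assumes "definable V R"
  shows "definable V (\<lambda>e. \<not> R e)"
proof -
  obtain \<phi> where "\<forall>e. range e \<subseteq> V \<longrightarrow> (sat V \<phi> e \<longleftrightarrow> R e)"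
    using assms unfolding definable_def by blast
  then show ?thesis
    unfolding definable_def by (intro exI[of _ "FNeg \<phi>"]) simp
qed

lemma definable_conj:
  assumes "definable V R" and "definable V S"
  shows "definable V (\<lambda>e. R e \<and> S e)"
proof -
  obtain \<phi> \<psi> where "\<forall>e. range e \<subseteq> V \<longrightarrow> (sat V \<phi> e \<longleftrightarrow> R e)"
    and "\<forall>e. range e \<subseteq> V \<longrightarrow> (sat V \<psi> e \<longleftrightarrow> S e)"
    using assms unfolding definable_def by blast
  then show ?thesis
    unfolding definable_def by (intro exI[of _ "FConj \<phi> \<psi>"]) simp
qed

lemma definable_all:
  assumes "definable V (\<lambda>e. Q (\<lambda>n. e (Suc n)) (e 0))"
  shows "definable V (\<lambda>e. \<forall>x\<in>V. Q e x)"
proof -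
  obtain \<phi> where "\<forall>e. range e \<subseteq> V \<longrightarrow> (sat V \<phi> e \<longleftrightarrow> Q (\<lambda>n. e (Suc n)) (e 0))"
    using assms unfolding definable_def by blast
  then have "sat V \<phi> (case_nat x e) \<longleftrightarrow> Q e x" if "range e \<subseteq> V" "x \<in> V" for e x
    using range_case_nat[OF that(2,1)] by simp
  then show ?thesis
    unfolding definable_def by (intro exI[of _ "FAll \<phi>"]) simp
qed

lemma definable_disj:
  assumes "definable V R" and "definable V S"
  shows "definable V (\<lambda>e. R e \<or> S e)"
  by (rule definable_cong[OF definable_not[OF definable_conj[OF assms[THEN definable_not]]]]) simp

lemma definable_imp:
  assumes "definable V R" and "definable V S"
  shows "definable V (\<lambda>e. R e \<longrightarrow> S e)"
  by (rule definable_cong[OF definable_disj[OF definable_not[OF assms(1)] assms(2)]]) simp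

lemma definable_iff:
  assumes "definable V R" and "definable V S"
  shows "definable V (\<lambda>e. R e \<longleftrightarrow> S e)"
  by (rule definable_cong[OF definable_conj[OF definable_imp[OF assms] definable_imp[OF assms(2,1)]]])
    auto

lemma definable_ex:
  assumes "definable V (\<lambda>e. Q (\<lambda>n. e (Suc n)) (e 0))"
  shows "definable V (\<lambda>e. \<exists>x\<in>V. Q e x)"
  by (rule definable_cong[OF definable_not[OF definable_all[where Q = "\<lambda>e x. \<not> Q e x"]]])
    (use definable_not[OF assms] in auto)

section \<open>Closure properties of transitive models of ZFC\<close>

definition hprod :: "hc \<Rightarrow> hc \<Rightarrow> hc" where
  "hprod a b = hset ((\<lambda>(x, y). hpair x y) ` (elts a \<times> elts b))"

lemma elts_hprod: "elts (hprod a b) = {hpair x y | x y. x \<in> elts a \<and> y \<in> elts b}"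
  unfolding hprod_def by (subst elts_hset) auto

lemma hset_eqI: "elts b = A \<Longrightarrow> hset A = b"
  by (metis countable_elts elts_hset hc_ext)

definition hUnion :: "hc \<Rightarrow> hc" where
  "hUnion x = hset (\<Union>(elts ` elts x))"

lemma elts_hUnion: "elts (hUnion x) = \<Union>(elts ` elts x)"
  unfolding hUnion_def by (rule elts_hset) simp

lemma hpair_components_in_hUnion:
  assumes "hpair y n \<in> elts R"
  shows "y \<in> elts (hUnion (hUnion R))" and "n \<in> elts (hUnion (hUnion R))"
proof -
  have "hset {y, n} \<in> elts (hUnion R)"
    unfolding elts_hUnion using assms by (intro UN_I[of "hpair y n"]) (simp_all add: elts_hpair)
  then have "elts (hset {y, n}) \<subseteq> elts (hUnion (hUnion R))"
    unfolding elts_hUnion[of "hUnion R"] by blast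
  then show "y \<in> elts (hUnion (hUnion R))" and "n \<in> elts (hUnion (hUnion R))"
    by simp_all
qed

locale zfc_model =
  fixes V :: "hc set"
  assumes V_ZFC: "transitive_model_ZFC V"
begin

lemma elts_in_V: "x \<in> V \<Longrightarrow> y \<in> elts x \<Longrightarrow> y \<in> V"
  using V_ZFC unfolding transitive_model_ZFC_def transitive_model_def by blast

lemma hpair_in_VD:
  assumes "hpair a b \<in> V"
  shows "a \<in> V \<and> b \<in> V"
proof -
  have "hset {a, b} \<in> V"
    by (rule elts_in_V[OF assms]) (simp add: elts_hpair)
  then show ?thesis
    using elts_in_V[of "hset {a, b}"] by auto
qed

lemma hpair_components_in_V:
  assumes "range e \<subseteq> V" and "hpair a b \<in> elts (e i)"
  shows "a \<in> V \<and> b \<in> V"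
  by (rule hpair_in_VD, rule elts_in_V[OF _ assms(2)]) (use assms(1) in auto)

lemma definable_ball:
  assumes "definable V (\<lambda>e. Q (\<lambda>n. e (Suc n)) (e 0))"
  shows "definable V (\<lambda>e. \<forall>x\<in>elts (e i). Q e x)"
proof (rule definable_cong)
  show "definable V (\<lambda>e. \<forall>x\<in>V. x \<in> elts (e i) \<longrightarrow> Q e x)"
    by (intro definable_all definable_imp definable_mem assms)
qed (meson elts_in_V rangeI subsetD)

lemma definable_bex:
  assumes "definable V (\<lambda>e. Q (\<lambda>n. e (Suc n)) (e 0))"
  shows "definable V (\<lambda>e. \<exists>x\<in>elts (e i). Q e x)"
proof (rule definable_cong)
  show "definable V (\<lambda>e. \<exists>x\<in>V. x \<in> elts (e i) \<and> Q e x)"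
    by (intro definable_ex definable_conj definable_mem assms)
qed (meson elts_in_V rangeI subsetD)

lemmas definable_basic = definable_mem definable_eq definable_not definable_conj definable_disj
  definable_imp definable_iff definable_all definable_ex definable_ball definable_bex

lemma definable_eq_hpair: "definable V (\<lambda>e. e k = hpair (e i) (e j))"
proof (rule definable_cong)
  show "definable V (\<lambda>e. \<exists>a\<in>elts (e k). \<exists>b\<in>elts (e k). (\<forall>w\<in>elts (e k). w = a \<or> w = b) \<and>
      (e i \<in> elts a \<and> (\<forall>w\<in>elts a. w = e i)) \<and>
      (e i \<in> elts b \<and> e j \<in> elts b \<and> (\<forall>w\<in>elts b. w = e i \<or> w = e j)))"
    by (intro definable_basic)
  fix e :: "nat \<Rightarrow> hc"
  show "(\<exists>a\<in>elts (e k). \<exists>b\<in>elts (e k). (\<forall>w\<in>elts (e k). w = a \<or> w = b) \<and>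
      (e i \<in> elts a \<and> (\<forall>w\<in>elts a. w = e i)) \<and>
      (e i \<in> elts b \<and> e j \<in> elts b \<and> (\<forall>w\<in>elts b. w = e i \<or> w = e j)))
    \<longleftrightarrow> e k = hpair (e i) (e j)" (is "?l \<longleftrightarrow> ?r")
  proof
    assume ?l
    then obtain a b where ab: "elts (e k) = {a, b}" "elts a = {e i}" "elts b = {e i, e j}"
      by blast
    have "a = hset {e i}" "b = hset {e i, e j}"
      by (rule hc_ext, simp add: ab(2,3))+
    then show ?r
      by (intro hc_ext[of "e k"]) (simp add: ab(1) elts_hpair)
  qed (simp add: elts_hpair)
qed

lemma definable_hpair_mem: "definable V (\<lambda>e. hpair (e i) (e j) \<in> elts (e k))"
  by (rule definable_cong[where R = "\<lambda>e. \<exists>z\<in>elts (e k). z = hpair (e i) (e j)"])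
    (intro definable_basic definable_eq_hpair, simp)

text \<open>
  A pair that belongs to an element of a transitive \<open>V\<close> has its components in \<open>V\<close>, so these
  quantifiers may range over the whole type and still be definable over \<open>V\<close>.
\<close>

lemma definable_all_hpair:
  assumes "definable V (\<lambda>e. Q (\<lambda>n. e (Suc (Suc n))) (e (Suc 0)) (e 0))"
  shows "definable V (\<lambda>e. \<forall>a b. hpair a b \<in> elts (e i) \<longrightarrow> Q e a b)"
proof (rule definable_cong)
  show "definable V (\<lambda>e. \<forall>a\<in>V. \<forall>b\<in>V. hpair a b \<in> elts (e i) \<longrightarrow> Q e a b)"
    by (intro definable_basic definable_hpair_mem assms)
  fix e :: "nat \<Rightarrow> hc"
  assume "range e \<subseteq> V"
  have "a \<in> V \<and> b \<in> V" if "hpair a b \<in> elts (e i)" for a b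
    by (rule hpair_components_in_V[OF \<open>range e \<subseteq> V\<close> that])
  then show "(\<forall>a\<in>V. \<forall>b\<in>V. hpair a b \<in> elts (e i) \<longrightarrow> Q e a b) \<longleftrightarrow>
      (\<forall>a b. hpair a b \<in> elts (e i) \<longrightarrow> Q e a b)"
    by blast
qed

lemma definable_ex_hpair:
  assumes "definable V (\<lambda>e. Q (\<lambda>n. e (Suc (Suc n))) (e (Suc 0)) (e 0))"
  shows "definable V (\<lambda>e. \<exists>a b. hpair a b \<in> elts (e i) \<and> Q e a b)"
proof (rule definable_cong)
  show "definable V (\<lambda>e. \<exists>a\<in>V. \<exists>b\<in>V. hpair a b \<in> elts (e i) \<and> Q e a b)"
    by (intro definable_basic definable_hpair_mem assms)
  fix e :: "nat \<Rightarrow> hc"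
  assume "range e \<subseteq> V"
  have "a \<in> V \<and> b \<in> V" if "hpair a b \<in> elts (e i)" for a b
    by (rule hpair_components_in_V[OF \<open>range e \<subseteq> V\<close> that])
  then show "(\<exists>a\<in>V. \<exists>b\<in>V. hpair a b \<in> elts (e i) \<and> Q e a b) \<longleftrightarrow>
      (\<exists>a b. hpair a b \<in> elts (e i) \<and> Q e a b)"
    by blast
qed

lemma definable_triple_mem: "definable V (\<lambda>e. hpair (e i) (hpair (e j) (e l)) \<in> elts (e k))"
proof (rule definable_cong)
  show "definable V (\<lambda>e. \<exists>z\<in>V. z = hpair (e j) (e l) \<and> hpair (e i) z \<in> elts (e k))"
    by (intro definable_basic definable_hpair_mem definable_eq_hpair)
  show "(\<exists>z\<in>V. z = hpair (e j) (e l) \<and> hpair (e i) z \<in> elts (e k)) \<longleftrightarrow>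
      hpair (e i) (hpair (e j) (e l)) \<in> elts (e k)" if "range e \<subseteq> V" for e
    using that by (metis elts_in_V hpair_in_VD rangeI subsetD)
qed

lemmas definable_intros = definable_basic definable_eq_hpair definable_hpair_mem
  definable_triple_mem definable_all_hpair definable_ex_hpair

lemma separation:
  assumes "definable V R" and "range e \<subseteq> V" and "a \<in> V"
  shows "hset {x \<in> elts a. R (case_nat x e)} \<in> V"
proof -
  obtain \<phi> where \<phi>: "\<forall>e. range e \<subseteq> V \<longrightarrow> (sat V \<phi> e \<longleftrightarrow> R e)"
    using assms(1) unfolding definable_def by blast
  have "sat_separation V"
    using V_ZFC unfolding transitive_model_ZFC_def by blast
  then obtain b where b: "b \<in> V"
      "\<forall>x\<in>V. x \<in> elts b \<longleftrightarrow> x \<in> elts a \<and> sat V \<phi> (case_nat x e)"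
    using assms(2,3) unfolding sat_separation_def by blast
  have "sat V \<phi> (case_nat x e) \<longleftrightarrow> R (case_nat x e)" if "x \<in> V" for x
    using \<phi> range_case_nat[OF that assms(2)] by blast
  then have "elts b = {x \<in> elts a. R (case_nat x e)}"
    using b elts_in_V[OF b(1)] elts_in_V[OF assms(3)] by blast
  then show ?thesis
    using b(1) hset_eqI by metis
qed

lemma replacement:
  assumes "definable V R" and "range e \<subseteq> V" and "a \<in> V"
    and ex: "\<And>x. x \<in> elts a \<Longrightarrow> \<exists>!y. y \<in> V \<and> R (case_nat x (case_nat y e))"
  obtains b where "b \<in> V"
    and "elts b = {y \<in> V. \<exists>x\<in>elts a. R (case_nat x (case_nat y e))}"
proof -
  obtain \<phi> where \<phi>: "\<forall>e. range e \<subseteq> V \<longrightarrow> (sat V \<phi> e \<longleftrightarrow> R e)"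
    using assms(1) unfolding definable_def by blast
  have \<phi>R: "sat V \<phi> (case_nat x (case_nat y e)) \<longleftrightarrow> R (case_nat x (case_nat y e))"
    if "x \<in> V" "y \<in> V" for x y
    using \<phi> range_case_nat[OF that(1) range_case_nat[OF that(2) assms(2)]] by blast
  have "\<forall>x\<in>V. x \<in> elts a \<longrightarrow> (\<exists>!y. y \<in> V \<and> sat V \<phi> (case_nat x (case_nat y e)))"
    using ex \<phi>R by (metis (no_types, lifting))
  moreover have "sat_replacement V"
    using V_ZFC unfolding transitive_model_ZFC_def by blast
  ultimately obtain b where b: "b \<in> V" "\<forall>y\<in>V. y \<in> elts b \<longleftrightarrow>
      (\<exists>x\<in>V. x \<in> elts a \<and> sat V \<phi> (case_nat x (case_nat y e)))"
    using assms(2,3) unfolding sat_replacement_def by blast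
  have "elts b = {y \<in> V. \<exists>x\<in>elts a. R (case_nat x (case_nat y e))}"
    using b elts_in_V[OF b(1)] elts_in_V[OF assms(3)] \<phi>R by blast
  with b(1) show ?thesis
    by (rule that)
qed

lemma doubleton_in_V: "x \<in> V \<Longrightarrow> y \<in> V \<Longrightarrow> hset {x, y} \<in> V"
proof -
  assume xy: "x \<in> V" "y \<in> V"
  have "sat_pairing V"
    using V_ZFC unfolding transitive_model_ZFC_def by blast
  then obtain z where z: "z \<in> V" "\<forall>w\<in>V. w \<in> elts z \<longleftrightarrow> w = x \<or> w = y"
    using xy unfolding sat_pairing_def by blast
  then have "elts z = {x, y}"
    using elts_in_V[OF z(1)] xy by blast
  then show ?thesis
    using z(1) hset_eqI by metis
qed

lemma hpair_in_V: "x \<in> V \<Longrightarrow> y \<in> V \<Longrightarrow> hpair x y \<in> V"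
  unfolding hpair_def using doubleton_in_V[of x x] doubleton_in_V by simp

lemma hUnion_in_V: "x \<in> V \<Longrightarrow> hUnion x \<in> V"
proof -
  assume x: "x \<in> V"
  have "sat_union V"
    using V_ZFC unfolding transitive_model_ZFC_def by blast
  then obtain u where u: "u \<in> V"
      "\<forall>w\<in>V. w \<in> elts u \<longleftrightarrow> (\<exists>y\<in>V. y \<in> elts x \<and> w \<in> elts y)"
    using x unfolding sat_union_def by blast
  then have "elts u = \<Union>(elts ` elts x)"
    using elts_in_V[OF u(1)] elts_in_V[OF x] elts_in_V by blast
  then have "hUnion x = u"
    unfolding hUnion_def by (rule hset_eqI)
  then show ?thesis
    using u(1) by simp
qed

lemma Un_in_V: "x \<in> V \<Longrightarrow> y \<in> V \<Longrightarrow> hset (elts x \<union> elts y) \<in> V"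
  using hUnion_in_V[OF doubleton_in_V[of x y]] by (simp add: hUnion_def)

lemma power_in_V:
  assumes "x \<in> V"
  obtains p where "p \<in> V" and "\<And>w. w \<in> V \<Longrightarrow> w \<in> elts p \<longleftrightarrow> elts w \<subseteq> elts x"
proof -
  have "sat_power V"
    using V_ZFC unfolding transitive_model_ZFC_def by blast
  then obtain p where "p \<in> V"
      "\<forall>w\<in>V. w \<in> elts p \<longleftrightarrow> (\<forall>z\<in>V. z \<in> elts w \<longrightarrow> z \<in> elts x)"
    using assms unfolding sat_power_def by blast
  with that[of p] show ?thesis
    using elts_in_V by blast
qed

text \<open>
  The product is separated from the second power set of \<open>a \<union> b\<close>, since a pair \<open>(x, y)\<close> is a set
  of subsets of \<open>a \<union> b\<close>.
\<close>

lemma hprod_in_V: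
  assumes "a \<in> V" and "b \<in> V"
  shows "hprod a b \<in> V"
proof -
  obtain p where p: "p \<in> V" "\<And>w. w \<in> V \<Longrightarrow> w \<in> elts p \<longleftrightarrow> elts w \<subseteq> elts a \<union> elts b"
    using power_in_V[OF Un_in_V[OF assms]] by auto
  obtain q where q: "q \<in> V" "\<And>w. w \<in> V \<Longrightarrow> w \<in> elts q \<longleftrightarrow> elts w \<subseteq> elts p"
    using power_in_V[OF p(1)] by blast
  have "hpair x y \<in> elts q" if "x \<in> elts a" "y \<in> elts b" for x y
  proof -
    have xy: "x \<in> V" "y \<in> V"
      using that assms elts_in_V by blast+
    have "hset {x, x} \<in> elts p" "hset {x, y} \<in> elts p"
      using that using doubleton_in_V[OF xy(1) xy(1)] doubleton_in_V[OF xy] by (simp_all add: p(2))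
    then show ?thesis
      by (simp add: q(2) hpair_in_V xy elts_hpair)
  qed
  then have "elts (hprod a b) = {z \<in> elts q. \<exists>x\<in>elts a. \<exists>y\<in>elts b. z = hpair x y}"
    by (auto simp: elts_hprod)
  moreover have "hset {z \<in> elts q. \<exists>x\<in>elts a. \<exists>y\<in>elts b. z = hpair x y} \<in> V"
    using separation[of "\<lambda>e. \<exists>x\<in>elts (e (Suc 0)). \<exists>y\<in>elts (e (Suc (Suc 0))). e 0 = hpair x y"
        "case_nat a (\<lambda>_. b)" q] assms q(1) range_case_nat[of a V "\<lambda>_. b"]
    by (simp add: definable_intros image_subset_iff)
  ultimately show ?thesis
    by (metis hset_eqI)
qed
end

section \<open>Canonical names for the elements of the ground model\<close>

text \<open>
  The canonical name of \<open>x\<close>. All conditions, not just a greatest one, are attached to each element,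
  because a forcing notion need not have a greatest element.
\<close>

function check :: "hc \<Rightarrow> hc \<Rightarrow> hc" where
  "check P x = hprod (hset (check P ` elts x)) P"
  by auto
termination
proof (relation "inv_image mem_rel snd")
  show "wf (inv_image mem_rel (snd :: hc \<times> hc \<Rightarrow> hc))"
    by (intro wf_inv_image wf_mem_rel)
qed (simp add: mem_rel_def)

declare check.simps [simp del]

lemma elts_check: "elts (check P x) = {hpair (check P y) p | y p. y \<in> elts x \<and> p \<in> elts P}"
  by (subst check.simps) (auto simp: elts_hprod)

lemma is_name_check: "is_name P (check P x)"
proof (induction x rule: wf_induct_rule[OF wf_mem_rel])
  case (1 x)
  then show ?case
    by (intro is_name.intros) (auto simp: elts_check mem_rel_def)
qed

lemma val_check:
  assumes "G \<subseteq> elts P" and "G \<noteq> {}"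
  shows "val G (check P x) = x"
proof (induction x rule: wf_induct_rule[OF wf_mem_rel])
  case (1 x)
  have "elts (val G (check P x)) = (\<lambda>y. val G (check P y)) ` elts x"
    using assms by (auto simp: elts_val elts_check)
  also have "\<dots> = elts x"
    using 1 by (simp add: mem_rel_def)
  finally show ?case
    by (rule hc_ext)
qed

text \<open>
  The pairs in \<open>R\<close> form a piece of the graph of \<open>check P\<close> whose domain is transitive.
\<close>

definition check_approx :: "hc \<Rightarrow> hc \<Rightarrow> bool" where
  "check_approx P R \<longleftrightarrow> (\<forall>y n. hpair y n \<in> elts R \<longrightarrow>
    n = check P y \<and> (\<forall>z\<in>elts y. hpair z (check P z) \<in> elts R))"

context zfc_model
begin

text \<open>
  The right-hand side mentions only membership and pairing. It is the recursion equation of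
  \<open>check P\<close> together with transitivity of the domain, and it pins down the values by induction on
  membership.
\<close>

lemma check_approx_iff:
  assumes "P \<in> V" and "R \<in> V"
  shows "check_approx P R \<longleftrightarrow> (\<forall>y n. hpair y n \<in> elts R \<longrightarrow>
      (\<forall>z\<in>elts y. \<exists>m\<in>V. hpair z m \<in> elts R) \<and>
      (\<forall>u\<in>V. u \<in> elts n \<longleftrightarrow>
        (\<exists>z\<in>elts y. \<exists>m\<in>V. hpair z m \<in> elts R \<and> (\<exists>p\<in>elts P. u = hpair m p))))" (is "?l \<longleftrightarrow> ?r")
proof
  assume l: ?l
  show ?r
  proof (intro allI impI)
    fix y n
    assume yn: "hpair y n \<in> elts R"
    then have n: "n = check P y" and sub: "\<forall>z\<in>elts y. hpair z (check P z) \<in> elts R"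
      using l unfolding check_approx_def by blast+
    have ex: "\<exists>m\<in>V. hpair z m \<in> elts R" if "z \<in> elts y" for z
      using sub that hpair_in_VD elts_in_V[OF assms(2)] by blast
    have eq: "m = check P z" if "hpair z m \<in> elts R" for z m
      using l that unfolding check_approx_def by blast
    have "u \<in> elts n \<longleftrightarrow>
        (\<exists>z\<in>elts y. \<exists>m\<in>V. hpair z m \<in> elts R \<and> (\<exists>p\<in>elts P. u = hpair m p))" for u
      unfolding n elts_check using ex eq by fastforce
    with ex show "(\<forall>z\<in>elts y. \<exists>m\<in>V. hpair z m \<in> elts R) \<and>
      (\<forall>u\<in>V. u \<in> elts n \<longleftrightarrow>
        (\<exists>z\<in>elts y. \<exists>m\<in>V. hpair z m \<in> elts R \<and> (\<exists>p\<in>elts P. u = hpair m p)))"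
      by blast
  qed
next
  assume r: ?r
  have *: "\<forall>n. hpair y n \<in> elts R \<longrightarrow> n = check P y" for y
  proof (induction y rule: wf_induct_rule[OF wf_mem_rel])
    case (1 y)
    show ?case
    proof (intro allI impI)
      fix n
      assume yn: "hpair y n \<in> elts R"
      have IH: "m = check P z" if "z \<in> elts y" "hpair z m \<in> elts R" for z m
        using 1 that unfolding mem_rel_def by blast
      have total: "\<exists>m\<in>V. hpair z m \<in> elts R" if "z \<in> elts y" for z
        using r yn that by blast
      have n: "u \<in> elts n \<longleftrightarrow>
        (\<exists>z\<in>elts y. \<exists>m\<in>V. hpair z m \<in> elts R \<and> (\<exists>p\<in>elts P. u = hpair m p))" if "u \<in> V" for u
        using r yn that by blast
      have "n \<in> V"
        using hpair_in_VD elts_in_V[OF assms(2) yn] by blast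
      have "elts n = elts (check P y)"
      proof (intro equalityI subsetI)
        fix u
        assume "u \<in> elts n"
        then obtain z m p where "z \<in> elts y" "hpair z m \<in> elts R" "p \<in> elts P" "u = hpair m p"
          using n elts_in_V[OF \<open>n \<in> V\<close>] by blast
        then show "u \<in> elts (check P y)"
          using IH unfolding elts_check by blast
      next
        fix u
        assume "u \<in> elts (check P y)"
        then obtain z p where zp: "z \<in> elts y" "p \<in> elts P" "u = hpair (check P z) p"
          unfolding elts_check by blast
        then obtain m where m: "m \<in> V" "hpair z m \<in> elts R"
          using total by blast
        then have "u = hpair m p"
          using IH zp by blast
        moreover have "u \<in> V"
          using \<open>u = hpair m p\<close> hpair_in_V[OF m(1) elts_in_V[OF assms(1) zp(2)]] by simp
        ultimately show "u \<in> elts n"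
          using n zp m by blast
      qed
      then show "n = check P y"
        by (rule hc_ext)
    qed
  qed
  show ?l
    unfolding check_approx_def
  proof (intro allI impI conjI ballI)
    fix y n
    assume yn: "hpair y n \<in> elts R"
    show "n = check P y"
      using * yn by blast
    fix z
    assume "z \<in> elts y"
    then obtain m where "hpair z m \<in> elts R"
      using r yn by blast
    then show "hpair z (check P z) \<in> elts R"
      using * by blast
  qed
qed

lemma definable_check_approx: "definable V (\<lambda>e. check_approx (e i) (e j))"
proof (rule definable_cong)
  show "definable V (\<lambda>e. \<forall>y n. hpair y n \<in> elts (e j) \<longrightarrow>
      (\<forall>z\<in>elts y. \<exists>m\<in>V. hpair z m \<in> elts (e j)) \<and>
      (\<forall>u\<in>V. u \<in> elts n \<longleftrightarrow>
        (\<exists>z\<in>elts y. \<exists>m\<in>V. hpair z m \<in> elts (e j) \<and> (\<exists>p\<in>elts (e i). u = hpair m p))))"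
    by (intro definable_intros)
qed (rule check_approx_iff[symmetric], auto)

text \<open>
  Replacement, unlike collection, needs a functional relation. Choosing the least approximation
  defined at \<open>x\<close> makes it unique.
\<close>

definition least_check_approx :: "hc \<Rightarrow> hc \<Rightarrow> hc \<Rightarrow> bool" where
  "least_check_approx P x R \<longleftrightarrow> check_approx P R \<and> (\<exists>n\<in>V. hpair x n \<in> elts R) \<and>
    (\<forall>R'\<in>V. check_approx P R' \<and> (\<exists>n\<in>V. hpair x n \<in> elts R') \<longrightarrow> (\<forall>w\<in>elts R. w \<in> elts R'))"

lemma definable_least_check_approx: "definable V (\<lambda>e. least_check_approx (e i) (e j) (e k))"
  unfolding least_check_approx_def by (intro definable_intros definable_check_approx)

lemma least_check_approx_unique:
  assumes "least_check_approx P x R" "least_check_approx P x R'" "R \<in> V" "R' \<in> V"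
  shows "R = R'"
  using assms unfolding least_check_approx_def by (intro hc_ext) blast

text \<open>
  The union of the least approximations at the elements of \<open>x\<close> is in \<open>V\<close> by replacement. Its
  values at these elements give \<open>check P x\<close>, and adding the pair for \<open>x\<close> to it gives the least
  approximation at \<open>x\<close>.
\<close>

lemma ex_least_check_approx:
  assumes P: "P \<in> V" and "x \<in> V"
  shows "check P x \<in> V \<and> (\<exists>R\<in>V. least_check_approx P x R)"
  using assms(2)
proof (induction x rule: wf_induct_rule[OF wf_mem_rel])
  case (1 x)
  have x: "x \<in> V"
    by fact
  have IH: "check P z \<in> V \<and> (\<exists>R\<in>V. least_check_approx P z R)" if "z \<in> elts x" for z
    using 1 that elts_in_V[OF x] unfolding mem_rel_def by blast
  have D: "definable V (\<lambda>e. least_check_approx (e (Suc (Suc 0))) (e 0) (e (Suc 0)))"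
    by (rule definable_least_check_approx)
  have uniq: "\<exists>!R. R \<in> V \<and> least_check_approx P z R" if "z \<in> elts x" for z
    using IH[OF that] least_check_approx_unique by blast
  obtain b where b: "b \<in> V" "elts b = {R \<in> V. \<exists>z\<in>elts x. least_check_approx P z R}"
    using replacement[OF D range_const[OF P] x] uniq by auto
  define S where "S = hUnion b"
  have S: "S \<in> V"
    unfolding S_def by (rule hUnion_in_V[OF b(1)])
  have elts_S: "w \<in> elts S \<longleftrightarrow> (\<exists>R\<in>V. w \<in> elts R \<and> (\<exists>z\<in>elts x. least_check_approx P z R))" for w
    unfolding S_def elts_hUnion b(2) by blast
  have approx_S: "check_approx P S"
    unfolding check_approx_def elts_S least_check_approx_def
    unfolding check_approx_def by blast
  have dom_S: "hpair z (check P z) \<in> elts S" if "z \<in> elts x" for z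
  proof -
    obtain R where R: "R \<in> V" "least_check_approx P z R"
      using IH[OF \<open>z \<in> elts x\<close>] by blast
    then have "hpair z (check P z) \<in> elts R"
      unfolding least_check_approx_def check_approx_def by blast
    then show ?thesis
      using R that unfolding elts_S by blast
  qed
  define U where "U = hUnion (hUnion S)"
  have U: "U \<in> V"
    unfolding U_def by (intro hUnion_in_V S)
  have elts_U: "m \<in> elts U" if "hpair z m \<in> elts S" for z m
    unfolding U_def by (rule hpair_components_in_hUnion[OF that])
  have "hset {m \<in> elts U. \<exists>z\<in>elts x. hpair z m \<in> elts S} \<in> V"
    using separation[of "\<lambda>e. \<exists>z\<in>elts (e (Suc 0)). hpair z (e 0) \<in> elts (e (Suc (Suc 0)))"
        "case_nat x (\<lambda>_. S)" U, OF _ range_case_nat[OF x range_const[OF S]] U]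
    by (simp add: definable_intros)
  also have "{m \<in> elts U. \<exists>z\<in>elts x. hpair z m \<in> elts S} = check P ` elts x"
    using elts_U dom_S approx_S unfolding check_approx_def by blast
  finally have check_x: "check P x \<in> V"
    by (subst check.simps) (intro hprod_in_V P)
  define R where "R = hset (elts S \<union> elts (hset {hpair x (check P x), hpair x (check P x)}))"
  have R: "R \<in> V"
    unfolding R_def by (intro Un_in_V doubleton_in_V S hpair_in_V x check_x)
  have elts_R: "elts R = insert (hpair x (check P x)) (elts S)"
    unfolding R_def by simp
  have "least_check_approx P x R"
    unfolding least_check_approx_def
  proof (intro conjI ballI impI)
    show "check_approx P R"
      using approx_S dom_S unfolding check_approx_def elts_R by auto
    show "\<exists>n\<in>V. hpair x n \<in> elts R"
      using check_x elts_R by blast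
    fix R' w
    assume R': "R' \<in> V" "check_approx P R' \<and> (\<exists>n\<in>V. hpair x n \<in> elts R')" and w: "w \<in> elts R"
    then have xR': "hpair x (check P x) \<in> elts R'"
      unfolding check_approx_def by blast
    show "w \<in> elts R'"
    proof (cases "w \<in> elts S")
      case True
      then obtain R0 z where R0: "R0 \<in> V" "w \<in> elts R0" "z \<in> elts x" "least_check_approx P z R0"
        unfolding elts_S by blast
      have "hpair z (check P z) \<in> elts R'"
        using R'(2) xR' R0(3) unfolding check_approx_def by blast
      then show ?thesis
        using R0 R' IH[OF R0(3)] unfolding least_check_approx_def by blast
    qed (use w xR' in \<open>auto simp: elts_R\<close>)
  qed
  with check_x R show ?case
    by blast
qed

lemma check_in_V: "P \<in> V \<Longrightarrow> x \<in> V \<Longrightarrow> check P x \<in> V"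
  using ex_least_check_approx by blast

text \<open>
  The domain of an approximation is transitive, so this needs no second recursion. Any element of
  \<open>V\<close> can take the place of the set of conditions; \<open>x\<close> itself is at hand.
\<close>

lemma ex_transitive_superset:
  assumes "x \<in> V"
  obtains T where "T \<in> V" and "x \<in> elts T" and "\<And>y. y \<in> elts T \<Longrightarrow> elts y \<subseteq> elts T"
proof -
  obtain R where R: "R \<in> V" "least_check_approx x x R"
    using ex_least_check_approx[OF assms assms] by blast
  define U where "U = hUnion (hUnion R)"
  have U: "U \<in> V"
    unfolding U_def by (intro hUnion_in_V R)
  have elts_U: "z \<in> elts U" if "hpair z m \<in> elts R" for z m
    unfolding U_def by (rule hpair_components_in_hUnion[OF that])
  define T where "T = hset {y \<in> elts U. \<exists>n\<in>V. hpair y n \<in> elts R}"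
  have T: "T \<in> V"
    using separation[of "\<lambda>e. \<exists>n\<in>V. hpair (e 0) n \<in> elts (e (Suc 0))" "\<lambda>_. R" U,
        OF _ range_const[OF R(1)] U]
    by (simp add: definable_intros T_def)
  have elts_T: "y \<in> elts T \<longleftrightarrow> (\<exists>n. hpair y n \<in> elts R)" for y
  proof -
    have "n \<in> V" if "hpair y n \<in> elts R" for n
      using hpair_in_VD elts_in_V[OF R(1) that] by blast
    then show ?thesis
      unfolding T_def using elts_U by auto
  qed
  have approx: "hpair z (check x z) \<in> elts R" if "hpair y n \<in> elts R" "z \<in> elts y" for y n z
    using R(2) that unfolding least_check_approx_def check_approx_def by blast
  show ?thesis
  proof (rule that[OF T])
    show "x \<in> elts T"
      using R(2) unfolding least_check_approx_def elts_T by blast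
    show "elts y \<subseteq> elts T" if y: "y \<in> elts T" for y
    proof
      fix z
      assume z: "z \<in> elts y"
      obtain n where "hpair y n \<in> elts R"
        using y unfolding elts_T ..
      from approx[OF this z] show "z \<in> elts T"
        unfolding elts_T ..
    qed
  qed
qed

end

section \<open>Forcing equality of names\<close>

text \<open>
  Read \<open>(\<pi>, \<rho>, r) \<in> E\<close> as ``\<open>r\<close> forces \<open>\<pi> = \<rho>\<close>''. Then \<open>covers\<close> says that \<open>p\<close> forces \<open>\<sigma> \<subseteq> \<tau>\<close>, and
  \<open>uncovers\<close> that \<open>p\<close> forces some element of \<open>\<sigma>\<close> not to belong to \<open>\<tau>\<close>.
\<close>

definition covers :: "hc \<Rightarrow> hc \<Rightarrow> hc \<Rightarrow> hc \<Rightarrow> hc \<Rightarrow> hc \<Rightarrow> bool" where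
  "covers P le E \<sigma> \<tau> p \<longleftrightarrow>
    (\<forall>\<pi> s. hpair \<pi> s \<in> elts \<sigma> \<longrightarrow>
      (\<forall>q\<in>elts P. hpair q p \<in> elts le \<and> hpair q s \<in> elts le \<longrightarrow>
        (\<exists>r\<in>elts P. hpair r q \<in> elts le \<and>
          (\<exists>\<rho> t. hpair \<rho> t \<in> elts \<tau> \<and> hpair r t \<in> elts le \<and> hpair \<pi> (hpair \<rho> r) \<in> elts E))))"

definition uncovers :: "hc \<Rightarrow> hc \<Rightarrow> hc \<Rightarrow> hc \<Rightarrow> hc \<Rightarrow> hc \<Rightarrow> bool" where
  "uncovers P le E \<sigma> \<tau> p \<longleftrightarrow>
    (\<exists>\<pi> s. hpair \<pi> s \<in> elts \<sigma> \<and> hpair p s \<in> elts le \<and>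
      (\<forall>\<rho> t. hpair \<rho> t \<in> elts \<tau> \<longrightarrow>
        (\<forall>r\<in>elts P. hpair r p \<in> elts le \<and> hpair r t \<in> elts le \<longrightarrow>
          hpair \<pi> (hpair \<rho> r) \<notin> elts E)))"

lemma covers_mono:
  assumes "covers P le E \<sigma> \<tau> p"
    and "\<And>\<pi> s \<rho> t r. hpair \<pi> s \<in> elts \<sigma> \<Longrightarrow> hpair \<rho> t \<in> elts \<tau> \<Longrightarrow> r \<in> elts P \<Longrightarrow>
      hpair \<pi> (hpair \<rho> r) \<in> elts E \<Longrightarrow> hpair \<pi> (hpair \<rho> r) \<in> elts E'"
  shows "covers P le E' \<sigma> \<tau> p"
  unfolding covers_def
proof (intro allI impI ballI)
  fix \<pi> s q
  assume \<pi>: "hpair \<pi> s \<in> elts \<sigma>" and "q \<in> elts P"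
    and "hpair q p \<in> elts le \<and> hpair q s \<in> elts le"
  then obtain r \<rho> t where "r \<in> elts P" "hpair r q \<in> elts le"
    "hpair \<rho> t \<in> elts \<tau>" "hpair r t \<in> elts le" "hpair \<pi> (hpair \<rho> r) \<in> elts E"
    using assms(1) unfolding covers_def by blast
  then show "\<exists>r\<in>elts P. hpair r q \<in> elts le \<and>
      (\<exists>\<rho> t. hpair \<rho> t \<in> elts \<tau> \<and> hpair r t \<in> elts le \<and> hpair \<pi> (hpair \<rho> r) \<in> elts E')"
    using assms(2)[OF \<pi>] by blast
qed

lemma not_covers_imp_uncovers:
  assumes "\<not> covers P le E \<sigma> \<tau> p"
  obtains q where "q \<in> elts P" and "hpair q p \<in> elts le" and "uncovers P le E \<sigma> \<tau> q"
  using assms unfolding covers_def uncovers_def by blast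

context zfc_model
begin

lemma definable_covers: "definable V (\<lambda>e. covers (e i) (e j) (e k) (e l) (e m) (e n))"
  unfolding covers_def by (intro definable_intros)

lemma definable_uncovers: "definable V (\<lambda>e. uncovers (e i) (e j) (e k) (e l) (e m) (e n))"
  unfolding uncovers_def by (intro definable_intros)

text \<open>The quantifiers are restricted to \<open>V\<close> so that the notion is definable over \<open>V\<close> as it stands.\<close>

definition bisimulation :: "hc \<Rightarrow> hc \<Rightarrow> hc \<Rightarrow> bool" where
  "bisimulation P le F \<longleftrightarrow> (\<forall>\<sigma>\<in>V. \<forall>\<tau>\<in>V. \<forall>p\<in>V. hpair \<sigma> (hpair \<tau> p) \<in> elts F \<longrightarrow>
    covers P le F \<sigma> \<tau> p \<and> covers P le F \<tau> \<sigma> p)"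

lemma definable_bisimulation: "definable V (\<lambda>e. bisimulation (e i) (e j) (e k))"
  unfolding bisimulation_def by (intro definable_intros definable_covers)

text \<open>The recursive characterisation of forcing an equality, for names from \<open>T\<close>.\<close>

definition forces_eq_on :: "hc \<Rightarrow> hc \<Rightarrow> hc \<Rightarrow> hc \<Rightarrow> bool" where
  "forces_eq_on T P le E \<longleftrightarrow> (\<forall>\<sigma>\<in>elts T. \<forall>\<tau>\<in>elts T. \<forall>p\<in>elts P.
    hpair \<sigma> (hpair \<tau> p) \<in> elts E \<longleftrightarrow> covers P le E \<sigma> \<tau> p \<and> covers P le E \<tau> \<sigma> p)"

lemma transitive_hpairD:
  assumes "\<And>y. y \<in> elts T \<Longrightarrow> elts y \<subseteq> elts T" and "\<sigma> \<in> elts T" and "hpair \<pi> s \<in> elts \<sigma>"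
  shows "\<pi> \<in> elts T"
proof -
  have "hpair \<pi> s \<in> elts T"
    using assms by blast
  moreover have "hset {\<pi>} \<in> elts (hpair \<pi> s)" "\<pi> \<in> elts (hset {\<pi>})"
    by (simp_all add: elts_hpair)
  ultimately show ?thesis
    using assms(1) by blast
qed

text \<open>
  The operator \<open>F \<mapsto> {(\<sigma>, \<tau>, p). covers F \<sigma> \<tau> p \<and> covers F \<tau> \<sigma> p}\<close> is monotone, and the bisimulations
  are its postfixed points. As in the Knaster-Tarski theorem, the union \<open>E\<close> of those in \<open>V\<close>,
  restricted to \<open>T \<times> T \<times> P\<close>, is a fixed point; one separation puts \<open>E\<close> into \<open>V\<close>. Transitivity of
  \<open>T\<close> ensures that the restriction does not remove any triples needed as witnesses.
\<close>

lemma ex_forces_eq_on: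
  assumes T: "T \<in> V" "\<And>y. y \<in> elts T \<Longrightarrow> elts y \<subseteq> elts T" and P: "P \<in> V" and le: "le \<in> V"
  obtains E where "E \<in> V" and "forces_eq_on T P le E"
proof -
  define W where "W = hprod T (hprod T P)"
  have W: "W \<in> V"
    unfolding W_def by (intro hprod_in_V T P)
  have elts_W: "hpair \<sigma> (hpair \<tau> p) \<in> elts W \<longleftrightarrow> \<sigma> \<in> elts T \<and> \<tau> \<in> elts T \<and> p \<in> elts P" for \<sigma> \<tau> p
    unfolding W_def by (auto simp: elts_hprod)
  define E where "E = hset {z \<in> elts W. \<exists>F\<in>V. bisimulation P le F \<and> z \<in> elts F}"
  have E: "E \<in> V"
    using separation[of "\<lambda>e. \<exists>F\<in>V. bisimulation (e (Suc 0)) (e (Suc (Suc 0))) F \<and> e 0 \<in> elts F"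
        "case_nat P (\<lambda>_. le)" W, OF _ range_case_nat[OF P range_const[OF le]] W]
    by (simp add: definable_intros definable_bisimulation E_def)
  have elts_E: "z \<in> elts E \<longleftrightarrow> z \<in> elts W \<and> (\<exists>F\<in>V. bisimulation P le F \<and> z \<in> elts F)" for z
    unfolding E_def by simp
  have E_bisim: "covers P le E \<sigma> \<tau> p \<and> covers P le E \<tau> \<sigma> p"
    if tri: "hpair \<sigma> (hpair \<tau> p) \<in> elts E" for \<sigma> \<tau> p
  proof -
    obtain F where F: "F \<in> V" "bisimulation P le F" "hpair \<sigma> (hpair \<tau> p) \<in> elts F"
      using tri unfolding elts_E by blast
    have in_T: "\<sigma> \<in> elts T" "\<tau> \<in> elts T" "p \<in> elts P"
      using tri unfolding elts_E elts_W by blast+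
    then have "\<sigma> \<in> V" "\<tau> \<in> V" "p \<in> V"
      using elts_in_V T(1) P by blast+
    then have F_covers: "covers P le F \<sigma> \<tau> p" "covers P le F \<tau> \<sigma> p"
      using F(2,3) unfolding bisimulation_def by blast+
    have F_E: "hpair \<pi> (hpair \<rho> r) \<in> elts E"
      if "\<pi> \<in> elts T" "\<rho> \<in> elts T" "r \<in> elts P" "hpair \<pi> (hpair \<rho> r) \<in> elts F" for \<pi> \<rho> r
      using that F(1,2) unfolding elts_E elts_W by blast
    show ?thesis
      by (intro conjI covers_mono[OF F_covers(1)] covers_mono[OF F_covers(2)] F_E)
        (use transitive_hpairD[OF T(2)] in_T in blast)+
  qed
  have "hpair \<sigma> (hpair \<tau> p) \<in> elts E"
    if in_T: "\<sigma> \<in> elts T" "\<tau> \<in> elts T" "p \<in> elts P"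
      and cov: "covers P le E \<sigma> \<tau> p" "covers P le E \<tau> \<sigma> p" for \<sigma> \<tau> p
  proof -
    \<comment> \<open>Adding to \<open>E\<close> one triple that it already justifies gives again a bisimulation.\<close>
    define z where "z = hpair \<sigma> (hpair \<tau> p)"
    have z: "z \<in> elts W"
      unfolding z_def elts_W using in_T by blast
    define E' where "E' = hset (elts E \<union> elts (hset {z, z}))"
    have "E' \<in> V"
      unfolding E'_def by (intro Un_in_V doubleton_in_V E elts_in_V[OF W z])
    moreover have elts_E': "elts E' = insert z (elts E)"
      unfolding E'_def by simp
    moreover have "bisimulation P le E'"
      unfolding bisimulation_def
    proof (intro ballI impI)
      fix \<sigma>' \<tau>' p'
      assume "hpair \<sigma>' (hpair \<tau>' p') \<in> elts E'"
      then have "covers P le E \<sigma>' \<tau>' p' \<and> covers P le E \<tau>' \<sigma>' p'"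
        using cov E_bisim unfolding elts_E' z_def by auto
      then show "covers P le E' \<sigma>' \<tau>' p' \<and> covers P le E' \<tau>' \<sigma>' p'"
        using covers_mono[of P le E _ _ p' E'] elts_E' by blast
    qed
    ultimately show ?thesis
      using z unfolding elts_E z_def by blast
  qed
  then have "forces_eq_on T P le E"
    unfolding forces_eq_on_def using E_bisim by blast
  with E show ?thesis
    by (rule that)
qed

end

section \<open>Truth of forced equalities and closure of extensions under intersection\<close>

locale generic_filter = zfc_model +
  fixes P le :: hc and G :: "hc set"
  assumes forcing: "forcing_notion V P le" and generic: "generic V P le G"
begin

lemma P_in_V: "P \<in> V" and le_in_V: "le \<in> V"
  using forcing unfolding forcing_notion_def by blast+

lemma le_refl: "p \<in> elts P \<Longrightarrow> hpair p p \<in> elts le"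
  using forcing unfolding forcing_notion_def preorder_on_def refl_on_def hrel_def by blast

lemma le_trans: "hpair p q \<in> elts le \<Longrightarrow> hpair q r \<in> elts le \<Longrightarrow> hpair p r \<in> elts le"
  using forcing unfolding forcing_notion_def preorder_on_def trans_def hrel_def by blast

lemma le_in_P: "hpair p q \<in> elts le \<Longrightarrow> p \<in> elts P \<and> q \<in> elts P"
  using forcing unfolding forcing_notion_def preorder_on_def hrel_def by blast

lemma G_subset: "G \<subseteq> elts P" and G_nonempty: "G \<noteq> {}"
  using generic unfolding generic_def by blast+

lemma G_upward: "p \<in> G \<Longrightarrow> hpair p q \<in> elts le \<Longrightarrow> q \<in> G"
  using generic le_in_P unfolding generic_def hrel_def by blast

lemma G_directed:
  assumes "p \<in> G" and "q \<in> G"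
  obtains r where "r \<in> G" and "hpair r p \<in> elts le" and "hpair r q \<in> elts le"
  using assms generic unfolding generic_def hrel_def by blast

lemma G_meets_dense:
  assumes "D \<in> V" and "elts D \<subseteq> elts P"
    and "\<And>p. p \<in> elts P \<Longrightarrow> \<exists>q\<in>elts D. hpair q p \<in> elts le"
  obtains p where "p \<in> G" and "p \<in> elts D"
  using assms generic unfolding generic_def dense_in_def hrel_def by blast

text \<open>
  The set \<open>A\<close> becomes dense after adding the conditions incompatible with \<open>q\<close>, and none of those
  is in \<open>G\<close>, which is directed and contains \<open>q\<close>.
\<close>

lemma G_meets_dense_below:
  assumes A: "A \<in> V" and q: "q \<in> G"
    and dense: "\<And>q'. hpair q' q \<in> elts le \<Longrightarrow> \<exists>r\<in>elts A. hpair r q' \<in> elts le"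
  obtains r where "r \<in> G" and "r \<in> elts A"
proof -
  have qV: "q \<in> V"
    using q G_subset P_in_V elts_in_V by blast
  define D where "D = hset {r \<in> elts P. r \<in> elts A \<or>
    \<not> (\<exists>r'\<in>elts P. hpair r' r \<in> elts le \<and> hpair r' q \<in> elts le)}"
  have "definable V (\<lambda>e. e 0 \<in> elts (e (Suc 0)) \<or>
      \<not> (\<exists>r'\<in>elts (e (Suc (Suc 0))). hpair r' (e 0) \<in> elts (e (Suc (Suc (Suc 0)))) \<and>
        hpair r' (e (Suc (Suc (Suc (Suc 0))))) \<in> elts (e (Suc (Suc (Suc 0))))))"
    by (intro definable_intros)
  from separation[OF this, of "case_nat A (case_nat P (case_nat le (\<lambda>_. q)))" P]
  have "D \<in> V"
    unfolding D_def by (simp add: range_case_nat range_const A P_in_V le_in_V qV)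
  moreover have elts_D: "r \<in> elts D \<longleftrightarrow> r \<in> elts P \<and> (r \<in> elts A \<or>
    \<not> (\<exists>r'\<in>elts P. hpair r' r \<in> elts le \<and> hpair r' q \<in> elts le))" for r
    unfolding D_def by simp
  moreover have "\<exists>r\<in>elts D. hpair r p \<in> elts le" if p: "p \<in> elts P" for p
  proof (cases "\<exists>r'\<in>elts P. hpair r' p \<in> elts le \<and> hpair r' q \<in> elts le")
    case True
    then obtain r' where r': "hpair r' p \<in> elts le" "hpair r' q \<in> elts le"
      by blast
    then obtain r where "r \<in> elts A" "hpair r r' \<in> elts le"
      using dense by blast
    then show ?thesis
      using le_trans[OF _ r'(1)] le_in_P elts_D by blast
  next
    case False
    then show ?thesis
      using p le_refl elts_D by blast
  qed
  ultimately obtain r where r: "r \<in> G" "r \<in> elts D"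
    using G_meets_dense[of D] by blast
  then obtain r' where "hpair r' r \<in> elts le" "hpair r' q \<in> elts le"
    using G_directed q by blast
  then have "r \<in> elts A"
    using r(2) le_in_P elts_D by blast
  with r(1) show ?thesis
    by (rule that)
qed

text \<open>
  Given an element \<open>(\<pi>, s)\<close> of \<open>\<sigma>\<close> with \<open>s \<in> G\<close>, the conditions forcing \<open>\<pi>\<close> to equal an element
  of \<open>\<tau>\<close> that they also put into \<open>\<tau>\<close> are dense below any common extension of \<open>p\<close> and \<open>s\<close>. The
  assumption \<open>sound\<close> is the induction hypothesis of \<open>forces_eq_on_val\<close>.
\<close>

lemma val_subset_if_covers:
  assumes E: "E \<in> V" and \<tau>: "\<tau> \<in> V" and \<sigma>: "\<sigma> \<in> V" and p: "p \<in> G" and cov: "covers P le E \<sigma> \<tau> p"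
    and sound: "\<And>\<pi> s \<rho> t r. hpair \<pi> s \<in> elts \<sigma> \<Longrightarrow> hpair \<rho> t \<in> elts \<tau> \<Longrightarrow> r \<in> G \<Longrightarrow>
      hpair \<pi> (hpair \<rho> r) \<in> elts E \<Longrightarrow> val G \<pi> = val G \<rho>"
  shows "elts (val G \<sigma>) \<subseteq> elts (val G \<tau>)"
proof
  fix x
  assume "x \<in> elts (val G \<sigma>)"
  then obtain \<pi> s where \<pi>: "x = val G \<pi>" "s \<in> G" "hpair \<pi> s \<in> elts \<sigma>"
    unfolding elts_val by blast
  have \<pi>V: "\<pi> \<in> V"
    using \<pi>(3) \<sigma> elts_in_V hpair_in_VD by blast
  obtain q where q: "q \<in> G" "hpair q p \<in> elts le" "hpair q s \<in> elts le"
    using G_directed[OF p \<pi>(2)] by blast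
  define A where "A = hset {r \<in> elts P.
    \<exists>\<rho> t. hpair \<rho> t \<in> elts \<tau> \<and> hpair r t \<in> elts le \<and> hpair \<pi> (hpair \<rho> r) \<in> elts E}"
  have "definable V (\<lambda>e. \<exists>\<rho> t. hpair \<rho> t \<in> elts (e (Suc 0)) \<and>
      hpair (e 0) t \<in> elts (e (Suc (Suc 0))) \<and>
      hpair (e (Suc (Suc (Suc 0)))) (hpair \<rho> (e 0)) \<in> elts (e (Suc (Suc (Suc (Suc 0))))))"
    by (intro definable_intros)
  from separation[OF this, of "case_nat \<tau> (case_nat le (case_nat \<pi> (\<lambda>_. E)))" P]
  have A: "A \<in> V"
    unfolding A_def by (simp add: range_case_nat range_const \<tau> P_in_V le_in_V \<pi>V E)
  have elts_A: "r \<in> elts A \<longleftrightarrow> r \<in> elts P \<and>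
    (\<exists>\<rho> t. hpair \<rho> t \<in> elts \<tau> \<and> hpair r t \<in> elts le \<and> hpair \<pi> (hpair \<rho> r) \<in> elts E)" for r
    unfolding A_def by simp
  have "\<exists>r\<in>elts A. hpair r q' \<in> elts le" if q': "hpair q' q \<in> elts le" for q'
  proof -
    have "q' \<in> elts P" "hpair q' p \<in> elts le" "hpair q' s \<in> elts le"
      using q' q(2,3) le_trans le_in_P by blast+
    then obtain r where "r \<in> elts P" "hpair r q' \<in> elts le" "\<exists>\<rho> t. hpair \<rho> t \<in> elts \<tau> \<and>
        hpair r t \<in> elts le \<and> hpair \<pi> (hpair \<rho> r) \<in> elts E"
      using cov \<pi>(3) unfolding covers_def by meson
    then show ?thesis
      using elts_A by blast
  qed
  from G_meets_dense_below[OF A q(1) this] obtain r where r: "r \<in> G" "r \<in> elts A"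
    by blast
  then obtain \<rho> t where \<rho>: "hpair \<rho> t \<in> elts \<tau>" "hpair r t \<in> elts le" "hpair \<pi> (hpair \<rho> r) \<in> elts E"
    unfolding elts_A by blast
  have "val G \<pi> = val G \<rho>"
    by (rule sound[OF \<pi>(3) \<rho>(1) r(1) \<rho>(3)])
  then show "x \<in> elts (val G \<tau>)"
    unfolding elts_val \<pi>(1) using \<rho>(1) G_upward[OF r(1) \<rho>(2)] by blast
qed

lemma forces_eq_on_mono:
  assumes "forces_eq_on T P le E" and "\<sigma> \<in> elts T" and "\<tau> \<in> elts T"
    and "hpair \<sigma> (hpair \<tau> p) \<in> elts E" and "hpair q p \<in> elts le"
  shows "hpair \<sigma> (hpair \<tau> q) \<in> elts E"
proof -
  have "covers P le E \<sigma>' \<tau>' q" if "covers P le E \<sigma>' \<tau>' p" for \<sigma>' \<tau>'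
    using that le_trans[OF _ assms(5)] unfolding covers_def by blast
  then show ?thesis
    using assms le_in_P[OF assms(5)] unfolding forces_eq_on_def by blast
qed

text \<open>
  An element of \<open>\<sigma>\<close> witnessing \<open>uncovers\<close> would have the same value as some element of \<open>\<tau>\<close>, and by
  the induction hypothesis \<open>complete\<close> a condition in \<open>G\<close> would force this. A common extension in
  \<open>G\<close> of all the conditions involved contradicts the choice of the witness.
\<close>

lemma not_uncovers_if_val_subset:
  assumes E: "forces_eq_on T P le E" and T: "\<And>y. y \<in> elts T \<Longrightarrow> elts y \<subseteq> elts T"
    and in_T: "\<sigma> \<in> elts T" "\<tau> \<in> elts T" and p: "p \<in> G"
    and sub: "elts (val G \<sigma>) \<subseteq> elts (val G \<tau>)"
    and complete: "\<And>\<pi> s \<rho> t. hpair \<pi> s \<in> elts \<sigma> \<Longrightarrow> hpair \<rho> t \<in> elts \<tau> \<Longrightarrow> val G \<pi> = val G \<rho> \<Longrightarrow>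
      \<exists>r\<in>G. hpair \<pi> (hpair \<rho> r) \<in> elts E"
  shows "\<not> uncovers P le E \<sigma> \<tau> p"
proof
  assume "uncovers P le E \<sigma> \<tau> p"
  then obtain \<pi> s where \<pi>: "hpair \<pi> s \<in> elts \<sigma>" "hpair p s \<in> elts le"
    and un: "\<And>\<rho> t r. hpair \<rho> t \<in> elts \<tau> \<Longrightarrow> hpair r p \<in> elts le \<Longrightarrow> hpair r t \<in> elts le \<Longrightarrow>
      hpair \<pi> (hpair \<rho> r) \<notin> elts E"
    unfolding uncovers_def using le_in_P by blast
  have "val G \<pi> \<in> elts (val G \<sigma>)"
    unfolding elts_val using \<pi> G_upward[OF p] by blast
  then obtain \<rho> t where \<rho>: "t \<in> G" "hpair \<rho> t \<in> elts \<tau>" "val G \<pi> = val G \<rho>"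
    using sub unfolding elts_val[of G \<tau>] by blast
  obtain r where r: "r \<in> G" "hpair \<pi> (hpair \<rho> r) \<in> elts E"
    using complete[OF \<pi>(1) \<rho>(2,3)] by blast
  obtain q where q: "q \<in> G" "hpair q p \<in> elts le" "hpair q t \<in> elts le"
    using G_directed[OF p \<rho>(1)] by blast
  obtain q' where q': "hpair q' q \<in> elts le" "hpair q' r \<in> elts le"
    using G_directed[OF q(1) r(1)] by blast
  have "hpair \<pi> (hpair \<rho> q') \<in> elts E"
    using forces_eq_on_mono[OF E _ _ r(2) q'(2)] transitive_hpairD[OF T] in_T \<pi>(1) \<rho>(2) by blast
  then show False
    using un[OF \<rho>(2)] le_trans[OF q'(1)] q(2,3) by blast
qed

text \<open>
  The truth lemma for equality. The equality of \<open>\<tau>\<close> and \<open>\<sigma>\<close> refers to that of the elements of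
  \<open>\<tau>\<close> and of \<open>\<sigma>\<close>, in this order; therefore the induction on \<open>\<sigma>\<close> treats \<open>(\<sigma>, \<tau>)\<close> and \<open>(\<tau>, \<sigma>)\<close>
  at once. For completeness, the conditions that force the equality or refute one of the two
  inclusions are dense.
\<close>

lemma forces_eq_on_val:
  assumes T: "T \<in> V" "\<And>y. y \<in> elts T \<Longrightarrow> elts y \<subseteq> elts T"
    and E: "E \<in> V" "forces_eq_on T P le E"
    and "\<sigma> \<in> elts T" and "\<tau> \<in> elts T"
  shows "val G \<sigma> = val G \<tau> \<longleftrightarrow> (\<exists>p\<in>G. hpair \<sigma> (hpair \<tau> p) \<in> elts E)"
proof -
  define truth where "truth \<sigma> \<tau> \<longleftrightarrow>
    (val G \<sigma> = val G \<tau> \<longleftrightarrow> (\<exists>p\<in>G. hpair \<sigma> (hpair \<tau> p) \<in> elts E))" for \<sigma> \<tau>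
  have step: "truth \<sigma> \<tau>" if in_T: "\<sigma> \<in> elts T" "\<tau> \<in> elts T"
    and IH: "\<And>\<pi> s \<rho> t. hpair \<pi> s \<in> elts \<sigma> \<Longrightarrow> hpair \<rho> t \<in> elts \<tau> \<Longrightarrow> truth \<pi> \<rho> \<and> truth \<rho> \<pi>" for \<sigma> \<tau>
  proof -
    have V: "\<sigma> \<in> V" "\<tau> \<in> V"
      using in_T T(1) elts_in_V by blast+
    have "val G \<sigma> = val G \<tau>" if p: "p \<in> G" and tri: "hpair \<sigma> (hpair \<tau> p) \<in> elts E" for p
    proof -
      have cov: "covers P le E \<sigma> \<tau> p" "covers P le E \<tau> \<sigma> p"
        using E(2) in_T tri p G_subset unfolding forces_eq_on_def by blast+
      have "elts (val G \<sigma>) \<subseteq> elts (val G \<tau>)"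
        by (rule val_subset_if_covers[OF E(1) V(2,1) p cov(1)]) (use IH in \<open>auto simp: truth_def\<close>)
      moreover have "elts (val G \<tau>) \<subseteq> elts (val G \<sigma>)"
        by (rule val_subset_if_covers[OF E(1) V(1,2) p cov(2)]) (use IH in \<open>auto simp: truth_def\<close>)
      ultimately show ?thesis
        by (intro hc_ext) blast
    qed
    moreover have "\<exists>p\<in>G. hpair \<sigma> (hpair \<tau> p) \<in> elts E" if eq: "val G \<sigma> = val G \<tau>"
    proof -
      define D where "D = hset {p \<in> elts P. hpair \<sigma> (hpair \<tau> p) \<in> elts E \<or>
        uncovers P le E \<sigma> \<tau> p \<or> uncovers P le E \<tau> \<sigma> p}"
      let ?P = "Suc 0" and ?le = "Suc (Suc 0)" and ?E = "Suc (Suc (Suc 0))"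
        and ?\<sigma> = "Suc (Suc (Suc (Suc 0)))" and ?\<tau> = "Suc (Suc (Suc (Suc (Suc 0))))"
      have "definable V (\<lambda>e. hpair (e ?\<sigma>) (hpair (e ?\<tau>) (e 0)) \<in> elts (e ?E) \<or>
          uncovers (e ?P) (e ?le) (e ?E) (e ?\<sigma>) (e ?\<tau>) (e 0) \<or>
          uncovers (e ?P) (e ?le) (e ?E) (e ?\<tau>) (e ?\<sigma>) (e 0))"
        by (intro definable_intros definable_uncovers)
      from separation[OF this, of "case_nat P (case_nat le (case_nat E (case_nat \<sigma> (\<lambda>_. \<tau>))))" P]
      have "D \<in> V"
        unfolding D_def by (simp add: range_case_nat range_const V P_in_V le_in_V E(1))
      moreover have elts_D: "p \<in> elts D \<longleftrightarrow> p \<in> elts P \<and> (hpair \<sigma> (hpair \<tau> p) \<in> elts E \<or>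
        uncovers P le E \<sigma> \<tau> p \<or> uncovers P le E \<tau> \<sigma> p)" for p
        unfolding D_def by simp
      moreover have "\<exists>q\<in>elts D. hpair q p \<in> elts le" if p: "p \<in> elts P" for p
      proof (cases "covers P le E \<sigma> \<tau> p \<and> covers P le E \<tau> \<sigma> p")
        case True
        then have "hpair \<sigma> (hpair \<tau> p) \<in> elts E"
          using E(2) in_T p unfolding forces_eq_on_def by blast
        then show ?thesis
          using p le_refl elts_D by blast
      next
        case False
        then show ?thesis
          using not_covers_imp_uncovers[of P le E] elts_D by metis
      qed
      ultimately obtain p where p: "p \<in> G" "p \<in> elts D"
        using G_meets_dense[of D] by blast
      have "\<not> uncovers P le E \<sigma> \<tau> p"
        by (rule not_uncovers_if_val_subset[OF E(2) T(2) in_T p(1)])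
          (use eq IH in \<open>auto simp: truth_def\<close>)
      moreover have "\<not> uncovers P le E \<tau> \<sigma> p"
        by (rule not_uncovers_if_val_subset[OF E(2) T(2) in_T(2,1) p(1)])
          (use eq IH in \<open>auto simp: truth_def\<close>)
      ultimately show ?thesis
        using p elts_D by blast
    qed
    ultimately show ?thesis
      unfolding truth_def by blast
  qed
  have "\<sigma> \<in> elts T \<Longrightarrow> \<forall>\<tau>\<in>elts T. truth \<sigma> \<tau> \<and> truth \<tau> \<sigma>" for \<sigma>
  proof (induction \<sigma> rule: wf_induct_rule[OF wf_trancl[OF wf_mem_rel]])
    case (1 \<sigma>)
    have IH: "truth \<pi> \<rho> \<and> truth \<rho> \<pi>" if "hpair \<pi> s \<in> elts \<sigma>" "\<rho> \<in> elts T" for \<pi> s \<rho>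
      using 1 mem_rel_trancl_hpair[OF that(1)] transitive_hpairD[OF T(2) _ that(1)] that(2) by blast
    show ?case
      using step[of \<sigma>] step[of _ \<sigma>] IH transitive_hpairD[OF T(2)] 1(2) by meson
  qed
  then show ?thesis
    using assms unfolding truth_def by blast
qed

lemma ground_model_subset: "V \<subseteq> gen_ext V P G"
proof
  fix x
  assume "x \<in> V"
  then show "x \<in> gen_ext V P G"
    unfolding gen_ext_def using check_in_V[OF P_in_V] is_name_check
      val_check[OF G_subset G_nonempty, of x, symmetric] by (intro image_eqI) auto
qed

lemma is_name_hpairD: "is_name P \<tau> \<Longrightarrow> hpair \<pi> s \<in> elts \<tau> \<Longrightarrow> is_name P \<pi>"
  by (erule is_name.cases) (metis hpair_inject)

text \<open>
  A name for the intersection consists of the pairs \<open>(\<pi>, r)\<close> such that \<open>r\<close> puts \<open>\<pi>\<close> into \<open>\<sigma>\<close> and,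
  for some \<open>\<rho>\<close>, puts \<open>\<rho>\<close> into \<open>\<tau>\<close> and forces \<open>\<pi> = \<rho>\<close>.
\<close>

lemma sets_in_gen_ext_Int:
  assumes "A \<in> sets_in (gen_ext V P G)" and "B \<in> sets_in (gen_ext V P G)"
  shows "A \<inter> B \<in> sets_in (gen_ext V P G)"
proof -
  obtain \<sigma> \<tau> where \<sigma>: "\<sigma> \<in> V" "is_name P \<sigma>" "A = elts (val G \<sigma>)"
    and \<tau>: "\<tau> \<in> V" "B = elts (val G \<tau>)"
    using assms unfolding sets_in_def gen_ext_def by blast
  obtain T where T: "T \<in> V" "hpair \<sigma> \<tau> \<in> elts T" "\<And>y. y \<in> elts T \<Longrightarrow> elts y \<subseteq> elts T"
    using ex_transitive_superset[OF hpair_in_V[OF \<sigma>(1) \<tau>(1)]] by blast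
  have "hset {\<sigma>, \<tau>} \<in> elts T"
    using T(3)[OF T(2)] by (simp add: elts_hpair)
  from T(3)[OF this] have in_T: "\<sigma> \<in> elts T" "\<tau> \<in> elts T"
    by simp_all
  obtain E where E: "E \<in> V" "forces_eq_on T P le E"
    using ex_forces_eq_on[OF T(1,3) P_in_V le_in_V] by blast
  \<comment> \<open>The variable \<open>\<pi>'\<close>, equal to \<open>\<pi>\<close>, gives the quantifier the form of \<open>definable_ex_hpair\<close>.\<close>
  define N where "N = {w \<in> elts (hprod T P). \<exists>\<pi>\<in>V. \<exists>r\<in>V. w = hpair \<pi> r \<and>
    (\<exists>\<pi>' s. hpair \<pi>' s \<in> elts \<sigma> \<and> \<pi>' = \<pi> \<and> hpair r s \<in> elts le \<and>
      (\<exists>\<rho> t. hpair \<rho> t \<in> elts \<tau> \<and> hpair r t \<in> elts le \<and> hpair \<pi> (hpair \<rho> r) \<in> elts E))}"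
  let ?\<sigma> = "Suc 0" and ?\<tau> = "Suc (Suc 0)" and ?le = "Suc (Suc (Suc 0))"
    and ?E = "Suc (Suc (Suc (Suc 0)))"
  have "definable V (\<lambda>e. \<exists>\<pi>\<in>V. \<exists>r\<in>V. e 0 = hpair \<pi> r \<and>
    (\<exists>\<pi>' s. hpair \<pi>' s \<in> elts (e ?\<sigma>) \<and> \<pi>' = \<pi> \<and> hpair r s \<in> elts (e ?le) \<and>
      (\<exists>\<rho> t. hpair \<rho> t \<in> elts (e ?\<tau>) \<and> hpair r t \<in> elts (e ?le) \<and>
        hpair \<pi> (hpair \<rho> r) \<in> elts (e ?E))))"
    by (intro definable_intros)
  from separation[OF this, of "case_nat \<sigma> (case_nat \<tau> (case_nat le (\<lambda>_. E)))" "hprod T P"]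
  have N_V: "hset N \<in> V"
    unfolding N_def
    by (simp add: range_case_nat range_const \<sigma>(1) \<tau>(1) P_in_V le_in_V E(1) hprod_in_V T(1))
  define \<mu> where "\<mu> = hset N"
  have \<mu>V: "\<mu> \<in> V"
    unfolding \<mu>_def by (rule N_V)
  have elts_\<mu>_N: "elts \<mu> = N"
    unfolding \<mu>_def by (rule elts_hset) (simp add: N_def)
  have \<mu>_pairs: "\<exists>\<pi> r. w = hpair \<pi> r" if "w \<in> elts \<mu>" for w
    using that unfolding elts_\<mu>_N N_def by blast
  have elts_\<mu>: "hpair \<pi> r \<in> elts \<mu> \<longleftrightarrow> (\<exists>s \<rho> t. hpair \<pi> s \<in> elts \<sigma> \<and> hpair r s \<in> elts le \<and>
      hpair \<rho> t \<in> elts \<tau> \<and> hpair r t \<in> elts le \<and> hpair \<pi> (hpair \<rho> r) \<in> elts E)" (is "_ \<longleftrightarrow> ?r") for \<pi> r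
  proof
    assume r: ?r
    then have "\<pi> \<in> elts T" "r \<in> elts P"
      using transitive_hpairD[OF T(3) in_T(1)] le_in_P by blast+
    moreover from this have "\<pi> \<in> V" "r \<in> V"
      using T(1) P_in_V elts_in_V by blast+
    ultimately show "hpair \<pi> r \<in> elts \<mu>"
      using r unfolding elts_\<mu>_N N_def by (simp add: elts_hprod)
  qed (auto simp: elts_\<mu>_N N_def)
  have name: "is_name P \<mu>"
  proof (rule is_name.intros)
    fix w
    assume w: "w \<in> elts \<mu>"
    then obtain \<pi> r where \<pi>: "w = hpair \<pi> r"
      using \<mu>_pairs by blast
    then show "\<exists>\<pi> r. w = hpair \<pi> r \<and> is_name P \<pi> \<and> r \<in> elts P"
      using w is_name_hpairD[OF \<sigma>(2)] le_in_P unfolding elts_\<mu>[of \<pi> r, folded \<pi>] by blast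
  qed
  have truth: "val G \<pi> = val G \<rho> \<longleftrightarrow> (\<exists>p\<in>G. hpair \<pi> (hpair \<rho> p) \<in> elts E)"
    if "hpair \<pi> s \<in> elts \<sigma>" "hpair \<rho> t \<in> elts \<tau>" for \<pi> s \<rho> t
    using forces_eq_on_val[OF T(1,3) E] transitive_hpairD[OF T(3)] in_T that by blast
  have "elts (val G \<mu>) = A \<inter> B"
  proof (intro equalityI subsetI)
    fix x
    assume "x \<in> elts (val G \<mu>)"
    then obtain \<pi> r where \<pi>: "x = val G \<pi>" "r \<in> G" "hpair \<pi> r \<in> elts \<mu>"
      unfolding elts_val by blast
    then obtain s \<rho> t where *: "hpair \<pi> s \<in> elts \<sigma>" "hpair r s \<in> elts le"
        "hpair \<rho> t \<in> elts \<tau>" "hpair r t \<in> elts le" "hpair \<pi> (hpair \<rho> r) \<in> elts E"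
      unfolding elts_\<mu> by blast
    then have "x = val G \<rho>"
      using truth \<pi> by blast
    moreover have "s \<in> G" "t \<in> G"
      using G_upward[OF \<pi>(2)] * by blast+
    ultimately show "x \<in> A \<inter> B"
      using * \<pi>(1) unfolding \<sigma>(3) \<tau>(2) elts_val by blast
  next
    fix x
    assume "x \<in> A \<inter> B"
    then obtain \<pi> s \<rho> t where *: "x = val G \<pi>" "s \<in> G" "hpair \<pi> s \<in> elts \<sigma>"
        "x = val G \<rho>" "t \<in> G" "hpair \<rho> t \<in> elts \<tau>"
      unfolding \<sigma>(3) \<tau>(2) elts_val by blast
    then obtain p where p: "p \<in> G" "hpair \<pi> (hpair \<rho> p) \<in> elts E"
      using truth by metis
    obtain q where q: "q \<in> G" "hpair q s \<in> elts le" "hpair q t \<in> elts le"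
      using G_directed *(2,5) by blast
    obtain r where r: "r \<in> G" "hpair r q \<in> elts le" "hpair r p \<in> elts le"
      using G_directed[OF q(1) p(1)] by blast
    have "hpair \<pi> (hpair \<rho> r) \<in> elts E"
      using forces_eq_on_mono[OF E(2) _ _ p(2) r(3)] transitive_hpairD[OF T(3)] in_T *(3,6) by blast
    moreover have "hpair r s \<in> elts le" "hpair r t \<in> elts le"
      using le_trans[OF r(2)] q by blast+
    ultimately have "hpair \<pi> r \<in> elts \<mu>"
      unfolding elts_\<mu> using *(3,6) by blast
    then show "x \<in> elts (val G \<mu>)"
      unfolding elts_val *(1) using r(1) by blast
  qed
  then show ?thesis
    unfolding sets_in_def gen_ext_def using \<mu>V name by blast
qed

end

section \<open>Borel codes in a model and in a submodel\<close>

text \<open>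
  Every clause of the evaluation of codes commutes with intersecting by \<open>V\<close>, since the points of
  \<open>V\<close> are the points of \<open>N\<close> that lie in \<open>V\<close>.
\<close>

lemma codes_Int:
  assumes "V \<subseteq> N" and "codes d N c B"
  shows "codes d V c (B \<inter> V)"
  using assms(2)
proof (induction rule: codes.induct)
  case (compl c B)
  have "points d V - B \<inter> V = (points d N - B) \<inter> V"
    using assms(1) unfolding points_def by blast
  then show ?case
    using codes.compl[where c = c, OF compl.hyps(1) compl.IH] by simp
next
  case (union c B)
  have "(\<Union>i. B i \<inter> V) = (\<Union>i. B i) \<inter> V"
    by blast
  then show ?case
    using codes.union[where c = c, OF union.hyps(1) union.IH] by simp
next
  case (opens c)
  have "basic_open d V n = basic_open d N n \<inter> V" for n
    using assms(1) unfolding basic_open_def by (auto split: prod.split)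
  then have "(\<Union>n\<in>{n. c (Suc n) = 1}. basic_open d V n) =
      (\<Union>n\<in>{n. c (Suc n) = 1}. basic_open d N n) \<inter> V"
    by auto
  then show ?case
    using codes.opens[where c = c and d = d and N = V, OF opens] by simp
qed

lemma codes_extend:
  assumes "V \<subseteq> N" and "codes d V c B"
  obtains B' where "codes d N c B'" and "B = B' \<inter> V"
proof -
  have "\<exists>B'. codes d N c B'"
    using assms(2)
  proof (induction rule: codes.induct)
    case (compl c B)
    then show ?case
      using codes.compl by blast
  next
    case (union c B)
    then have "\<forall>i. \<exists>B'. codes d N (\<lambda>n. c (Suc (prod_encode (i, n)))) B'"
      by blast
    then obtain B' where "\<And>i. codes d N (\<lambda>n. c (Suc (prod_encode (i, n)))) (B' i)"
      by metis
    then show ?case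
      using codes.union[where c = c and B = B', OF union.hyps(1)] by blast
  next
    case (opens c)
    then show ?case
      using codes.opens by blast
  qed
  then obtain B' where B': "codes d N c B'" ..
  have "B = B' \<inter> V"
    by (rule codes_unique[OF assms(2) codes_Int[OF assms(1) B']])
  with B' show ?thesis
    by (rule that)
qed

section \<open>Preservation of Luzin sets\<close>

lemma coded_base_restrict:
  assumes "V \<subseteq> N" and "is_base (I N \<inter> borel_in d N \<inter> borel_coded d N V) (I N)"
    and "codes_absolute d I V N" and "A \<in> I N"
  obtains B where "A \<subseteq> B" and "B \<inter> V \<in> I V"
proof -
  obtain B where B: "B \<in> I N" "B \<in> borel_coded d N V" "A \<subseteq> B"
    using assms(2,4) unfolding is_base_def by blast
  then obtain c where c: "fun_code c \<in> V" "codes d N c B"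
    unfolding borel_coded_def by blast
  have "B \<inter> V \<in> I V"
    using assms(3) c codes_Int[OF assms(1) c(2)] B(1) unfolding codes_absolute_def by blast
  with B(3) show ?thesis
    by (rule that)
qed

lemma borel_base_extend:
  assumes "V \<subseteq> N" and "borel_sigma_ideal_in d V (J V)"
    and "codes_absolute d J V N" and "A \<in> J V"
  obtains B where "A \<subseteq> B" and "B \<in> J N"
proof -
  obtain D where D: "D \<in> J V" "D \<in> borel_in d V" "A \<subseteq> D"
    using assms(2,4) unfolding borel_sigma_ideal_in_def is_base_def by blast
  then obtain c where c: "fun_code c \<in> V" "codes d V c D"
    unfolding borel_coded_def by blast
  obtain B where B: "codes d N c B" "D = B \<inter> V"
    using codes_extend[OF assms(1) c(2)] by blast
  have "B \<in> J N"
    using assms(3) c B(1) D(1) unfolding codes_absolute_def by blast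
  with D(3) B(2) show ?thesis
    using that by blast
qed

lemma borel_sigma_ideal_in_downward:
  assumes "borel_sigma_ideal_in d N K" and "A \<in> K" and "B \<in> sets_in N" and "B \<subseteq> A"
  shows "B \<in> K"
proof -
  have "\<forall>A\<in>K. \<forall>B\<in>sets_in N. B \<subseteq> A \<longrightarrow> B \<in> K"
    using assms(1) unfolding borel_sigma_ideal_in_def sigma_ideal_in_def by (elim conjE)
  with assms(2-4) show ?thesis
    by blast
qed

text \<open>
  The combinatorial core, for an arbitrary extension \<open>N\<close> of \<open>V\<close>. Closure of \<open>N\<close> under intersection
  is needed because \<open>J(N)\<close> is closed only under those subsets that belong to \<open>N\<close>.
\<close>

lemma luzin_in_extend:
  assumes sub: "V \<subseteq> N"
    and Int: "\<And>A B. A \<in> sets_in N \<Longrightarrow> B \<in> sets_in N \<Longrightarrow> A \<inter> B \<in> sets_in N"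
    and IV: "borel_sigma_ideal_in d V (I V)" and JV: "borel_sigma_ideal_in d V (J V)"
    and IN: "borel_sigma_ideal_in d N (I N)" and JN: "borel_sigma_ideal_in d N (J N)"
    and base: "is_base (I N \<inter> borel_in d N \<inter> borel_coded d N V) (I N)"
    and absI: "codes_absolute d I V N" and absJ: "codes_absolute d J V N"
    and L: "luzin_in V (points d V) (I V) (J V) L"
  shows "luzin_in N (points d N) (I N) (J N) L"
proof -
  have L_set: "L \<in> sets_in V" and L_points: "L \<subseteq> points d V" and L_notin: "L \<notin> I V"
    and L_small: "\<And>B. B \<in> I V \<Longrightarrow> B \<inter> L \<in> J V"
    using L unfolding luzin_in_def by blast+
  have L_V: "L \<subseteq> V"
    using L_points unfolding points_def by blast
  have L_N: "L \<in> sets_in N"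
    using L_set sub unfolding sets_in_def by blast
  have "L \<notin> I N"
  proof
    assume "L \<in> I N"
    then obtain B where B: "L \<subseteq> B" "B \<inter> V \<in> I V"
      using coded_base_restrict[OF sub base absI] by blast
    have "L \<subseteq> B \<inter> V"
      using B(1) L_V by blast
    then have "L \<in> I V"
      using borel_sigma_ideal_in_downward[OF IV B(2) L_set] by blast
    with L_notin show False ..
  qed
  moreover have "A \<inter> L \<in> J N" if A: "A \<in> I N" for A
  proof -
    obtain B where B: "A \<subseteq> B" "B \<inter> V \<in> I V"
      using coded_base_restrict[OF sub base absI A] by blast
    obtain D where D: "B \<inter> V \<inter> L \<subseteq> D" "D \<in> J N"
      using borel_base_extend[OF sub JV absJ L_small[OF B(2)]] by blast
    have "I N \<subseteq> sets_in N"
      using IN unfolding borel_sigma_ideal_in_def sigma_ideal_in_def by (elim conjE)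
    then have "A \<in> sets_in N"
      using A ..
    then have "A \<inter> L \<in> sets_in N"
      using Int L_N by blast
    moreover have "A \<inter> L \<subseteq> D"
      using B(1) D(1) L_V by blast
    ultimately show ?thesis
      by (rule borel_sigma_ideal_in_downward[OF JN D(2)])
  qed
  moreover have "L \<subseteq> points d N"
    using L_points sub unfolding points_def by blast
  ultimately show ?thesis
    unfolding luzin_in_def using L_N by blast
qed

theorem theorem3p2:
  fixes V :: "hc set" and P le :: hc
    and d :: "nat \<Rightarrow> nat \<Rightarrow> real"
    and \<phi>\<^sub>I \<phi>\<^sub>J :: fm and e\<^sub>I e\<^sub>J :: "nat \<Rightarrow> hc"
    and I J :: "hc set \<Rightarrow> hc set set"
  defines "I \<equiv> interp \<phi>\<^sub>I e\<^sub>I" and "J \<equiv> interp \<phi>\<^sub>J e\<^sub>J"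
  assumes "transitive_model_ZFC V"
    and "Metric_space UNIV d" and "metric_code d \<in> V"
    and "\<not> countable_in V (points d V)"
    and "range e\<^sub>I \<subseteq> V" and "range e\<^sub>J \<subseteq> V"
    and "borel_sigma_ideal_in d V (I V)" and "borel_sigma_ideal_in d V (J V)"
    and "forcing_notion V P le"
    and "\<And>G. generic V P le G \<Longrightarrow> borel_sigma_ideal_in d (gen_ext V P G) (I (gen_ext V P G))"
    and "\<And>G. generic V P le G \<Longrightarrow> borel_sigma_ideal_in d (gen_ext V P G) (J (gen_ext V P G))"
    and "\<And>G. generic V P le G \<Longrightarrow>
      is_base (I (gen_ext V P G) \<inter> borel_in d (gen_ext V P G) \<inter> borel_coded d (gen_ext V P G) V)
        (I (gen_ext V P G))"
    and "\<And>G. generic V P le G \<Longrightarrow> codes_absolute d I V (gen_ext V P G)"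
    and "\<And>G. generic V P le G \<Longrightarrow> codes_absolute d J V (gen_ext V P G)"
  shows "preserves_luzin V P le d I J"
  unfolding preserves_luzin_def
proof (intro allI impI)
  fix L G
  assume L: "luzin_in V (points d V) (I V) (J V) L" and G: "generic V P le G"
  interpret generic_filter V P le G
    using assms(3,11) G by unfold_locales
  show "luzin_in (gen_ext V P G) (points d (gen_ext V P G))
      (I (gen_ext V P G)) (J (gen_ext V P G)) L"
    by (rule luzin_in_extend[where I = I and J = J, OF ground_model_subset sets_in_gen_ext_Int
        assms(9,10) assms(12-16)[OF G] L])
qed

end
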